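(* Every instance of fair allocation of goods with additive valuations having $n \ge 8$ agents and $m = n + 7$ goods admits an MMS allocation.
   Context: An instance of fair allocation of goods consists of a set $N=\{1,\dots,n\}$ of agents, a set $M=\{1,\dots,m\}$ of goods, and for each agent $i$ an additive valuation $v_i:2^M\to\mathbb{R}$ with $v_i(\emptyset)=0$, $v_i(S)=\sum_{g\in S}v_i(\{g\})$ and $v_i(\{g\})\ge 0$. An allocation is an ordered $n$-tuple $\langle A_1,\dots,A_n\rangle$ of pairwise disjoint (possibly empty) subsets of $M$ with union $M$. The maximin share of agent $i$ is $\mu_i=\max_{A}\min_{j} v_i(A_j)$ over all allocations $A$. An MMS allocation is an allocation with $v_i(A_i)\ge\mu_i$ for all $i$. *)

theory Defs
  imports Main "HOL.Real"
begin

text \<open>Agents are 1..n, goods are 1..m. An additive valuation of agent i is given by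
  the values v i g of the single goods g; the value of a bundle S is the sum.\<close>

definition bundle_value :: "(nat \<Rightarrow> nat \<Rightarrow> real) \<Rightarrow> nat \<Rightarrow> nat set \<Rightarrow> real" where
  "bundle_value v i S = (\<Sum>g\<in>S. v i g)"

definition is_allocation :: "nat \<Rightarrow> nat \<Rightarrow> (nat \<Rightarrow> nat set) \<Rightarrow> bool" where
  "is_allocation n m A \<longleftrightarrow>
     (\<forall>i\<in>{1..n}. \<forall>j\<in>{1..n}. i \<noteq> j \<longrightarrow> A i \<inter> A j = {}) \<and>
     (\<Union>i\<in>{1..n}. A i) = {1..m}"

definition mms :: "nat \<Rightarrow> nat \<Rightarrow> (nat \<Rightarrow> nat \<Rightarrow> real) \<Rightarrow> nat \<Rightarrow> real" where
  "mms n m v i = Max {Min ((\<lambda>j. bundle_value v i (A j)) ` {1..n}) | A. is_allocation n m A}"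

definition is_mms_allocation :: "nat \<Rightarrow> nat \<Rightarrow> (nat \<Rightarrow> nat \<Rightarrow> real) \<Rightarrow> (nat \<Rightarrow> nat set) \<Rightarrow> bool" where
  "is_mms_allocation n m v A \<longleftrightarrow>
     is_allocation n m A \<and> (\<forall>i\<in>{1..n}. bundle_value v i (A i) \<ge> mms n m v i)"

end

theory Submission
  imports Defs "HOL-Library.Disjoint_Sets"
begin

text \<open>One may assume that all agents rank the goods in the same order: a solution of the sorted
  instance is a picking sequence for the original one. Then a bundle that dominates another one
  position by position is worth at least as much to everybody, so an agent one of whose bundles
  dominates \<open>X\<close> can lose one bundle together with the goods \<open>X\<close>; and an agent who values \<open>X\<close> at
  most at her share can merge the two bundles that meet \<open>X\<close>. With more than eight agents the
  best good satisfies everybody, so eight agents and fifteen goods remain.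

  An agent who rejects the good number \<open>k + 1\<close> has no singleton bundle after the first \<open>k\<close> goods are
  removed, hence many bundles of size two. If many agents have a pair with the same better good \<open>a\<close>,
  then \<open>a\<close> is handed out with its worst partner that somebody still accepts. This ends with three
  agents, where an unsatisfiable instance is so rigid (bundles that the other agents reject meet
  all their bundles) that few agents can belong to it. Agents who accept an early good wait and
  are served with the early goods at the end.\<close>

subsection \<open>Bundles and feasible partitions\<close>

text \<open>Fifteen goods are fewer than twice eight, so everybody accepts the best good, but giving
  it away first would leave seven agents with fourteen goods, a size that no lemma covers:
  \<open>n\<close> agents are solved with \<open>n + 5\<close> goods, and seven agents with
  thirteen. The way round is to hand out two goods at once. Two of the best nine goods share one of
  eight bundles, which dominates the pair of goods number 8 and 9; if anybody accepts this pair,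
  seven agents with thirteen goods remain. If nobody does, the better good of an accepted pair is
  among the best seven. An agent who rejects good number \<open>k + 1\<close> then has at least
  \<open>3(8 - k) - (15 - k) = 9 - 2k\<close> pairs, whose different better goods are among
  \<open>7 - k\<close> goods. This is impossible for \<open>k = 0\<close> and \<open>k = 1\<close>
  and tight for \<open>k = 2\<close>, where every candidate must occur. Agents may wait for the
  early goods as long as, for each \<open>t\<close>, at most \<open>t\<close> of them reject good
  number \<open>t + 1\<close>. The case distinctions by numbers of rejecting agents serve to choose
  the agents who are treated first so that this Hall condition holds for the others.\<close>

text \<open>Small numbers are the valuable goods.\<close>
definition dominates :: "nat set \<Rightarrow> nat set \<Rightarrow> bool" where
  "dominates Y X \<longleftrightarrow> (\<exists>h. inj_on h X \<and> h ` X \<subseteq> Y \<and> (\<forall>x\<in>X. h x \<le> x))"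

definition share :: "(nat \<Rightarrow> nat) \<Rightarrow> nat set \<Rightarrow> nat \<Rightarrow> nat set" where
  "share f G k = {g\<in>G. f g = k}"

lemma share_subset: "share f G k \<subseteq> G"
  by (auto simp: share_def)

lemma finite_share: "finite G \<Longrightarrow> finite (share f G k)"
  by (auto simp: share_def)

lemma share_disjoint: "k \<noteq> l \<Longrightarrow> share f G k \<inter> share f G l = {}"
  by (auto simp: share_def)

lemma dominates_pair:
  assumes "a \<in> Y" "b \<in> Y" "a \<noteq> b" "a \<le> c" "b \<le> d" "c \<noteq> d"
  shows "dominates Y {c, d}"
proof -
  have "inj_on (\<lambda>x. if x = c then a else b) {c, d}" using assms by (simp add: inj_on_def)
  then show ?thesis
    unfolding dominates_def using assms by (intro exI[of _ "\<lambda>x. if x = c then a else b"]) simp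
qed

lemma dominates_triple:
  assumes "{a, b, c} \<subseteq> Y" "a \<noteq> b" "a \<noteq> c" "b \<noteq> c" "a \<le> d" "b \<le> e" "c \<le> f" "d \<noteq> e" "d \<noteq> f" "e \<noteq> f"
  shows "dominates Y {d, e, f}"
proof -
  let ?h = "\<lambda>x. if x = d then a else if x = e then b else c"
  have h: "?h d = a" "?h e = b" "?h f = c" using assms by auto
  have "inj_on ?h {d, e, f}" using h assms(2-4) unfolding inj_on_def by (metis insertE singletonD)
  moreover have "?h ` {d, e, f} = {a, b, c}" by (simp only: image_insert image_empty h)
  moreover have "\<forall>x\<in>{d, e, f}. ?h x \<le> x" using h assms(5-7) by (metis insertE singletonD)
  ultimately show ?thesis
    unfolding dominates_def using assms(1) by (intro exI[of _ ?h]) blast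
qed

lemma dominates_if_counts:
  assumes "finite X" "finite Y" "\<And>t. card (X \<inter> {..t}) \<le> card (Y \<inter> {..t})"
  shows "dominates Y X"
  using assms
proof (induction X rule: finite_linorder_max_induct)
  case empty
  then show ?case by (simp add: dominates_def)
next
  case (insert b A)
  have bA: "b \<notin> A" using insert.hyps by auto
  have "card (A \<inter> {..t}) \<le> card (Y \<inter> {..t})" for t
  proof -
    have "card (A \<inter> {..t}) \<le> card (insert b A \<inter> {..t})"
      using insert.hyps by (intro card_mono) auto
    with insert.prems(2)[of t] show ?thesis by linarith
  qed
  with insert.IH[OF insert.prems(1)] obtain h
    where h: "inj_on h A" "h ` A \<subseteq> Y" "\<forall>x\<in>A. h x \<le> x"
    unfolding dominates_def by blast
  have "insert b A \<inter> {..b} = insert b A" using insert.hyps by auto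
  then have "Suc (card A) \<le> card (Y \<inter> {..b})"
    using insert.prems(2)[of b] insert.hyps bA by simp
  moreover have "card (h ` A) = card A" using h(1) by (rule card_image)
  ultimately have "\<not> Y \<inter> {..b} \<subseteq> h ` A"
    using card_mono[of "h ` A" "Y \<inter> {..b}"] insert.hyps by auto
  then obtain y where y: "y \<in> Y" "y \<le> b" "y \<notin> h ` A" by auto
  have "inj_on (h(b := y)) (insert b A)"
    using h(1) y(3) bA by (auto simp: inj_on_def)
  moreover have "(h(b := y)) ` insert b A \<subseteq> Y" using h(2) y(1) bA by auto
  moreover have "\<forall>x\<in>insert b A. (h(b := y)) x \<le> x" using h(3) y(2) by auto
  ultimately show ?case unfolding dominates_def by blast
qed

lemma dominates_counts:
  assumes "dominates Y X" "finite Y"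
  shows "card (X \<inter> {..t}) \<le> card (Y \<inter> {..t})"
proof -
  obtain h where h: "inj_on h X" "h ` X \<subseteq> Y" "\<forall>x\<in>X. h x \<le> x"
    using assms unfolding dominates_def by blast
  have "card (X \<inter> {..t}) = card (h ` (X \<inter> {..t}))"
    using h(1) by (simp add: card_image inj_on_subset)
  also have "\<dots> \<le> card (Y \<inter> {..t})"
    using h(2,3) assms(2) by (intro card_mono) (auto intro: order_trans)
  finally show ?thesis .
qed

text \<open>Common goods cancel in the counts, whereas a given injection would have to be rerouted.
  The exchange in \<open>part_spare\<close> needs replacements outside \<open>X\<close>, since the
  goods of \<open>X\<close> leave.\<close>

lemma dominates_diff:
  assumes "dominates Y X" "finite X" "finite Y"
  shows "dominates (Y - X) (X - Y)"
proof (rule dominates_if_counts)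
  fix t
  have X: "X \<inter> {..t} = ((X - Y) \<inter> {..t}) \<union> (X \<inter> Y \<inter> {..t})"
    and Y: "Y \<inter> {..t} = ((Y - X) \<inter> {..t}) \<union> (X \<inter> Y \<inter> {..t})" by auto
  have "card (X \<inter> {..t}) = card ((X - Y) \<inter> {..t}) + card (X \<inter> Y \<inter> {..t})"
    by (subst X, rule card_Un_disjoint) (use assms in auto)
  moreover have "card (Y \<inter> {..t}) = card ((Y - X) \<inter> {..t}) + card (X \<inter> Y \<inter> {..t})"
    by (subst Y, rule card_Un_disjoint) (use assms in auto)
  ultimately show "card ((X - Y) \<inter> {..t}) \<le> card ((Y - X) \<inter> {..t})"
    using dominates_counts[OF assms(1,3), of t] by linarith
qed (use assms in auto)

text \<open>The thresholds \<open>mu\<close> stay abstract; maximin shares enter only with the final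
  interpretation. Both assumptions range over all indices, which avoids side conditions
  throughout.\<close>

locale ordered_goods =
  fixes v :: "nat \<Rightarrow> nat \<Rightarrow> real" and mu :: "nat \<Rightarrow> real"
  assumes nonneg: "0 \<le> v i g"
    and anti: "g \<le> h \<Longrightarrow> v i h \<le> v i g"
begin

definition val :: "nat \<Rightarrow> nat set \<Rightarrow> real" where
  "val i S = sum (v i) S"

text \<open>The label set \<open>I\<close> is arbitrary, so that losing or merging a bundle deletes
  one label and leaves the others as they are.\<close>

definition part :: "nat \<Rightarrow> nat set \<Rightarrow> nat set \<Rightarrow> (nat \<Rightarrow> nat) \<Rightarrow> bool" where
  "part i I G f \<longleftrightarrow> finite I \<and> finite G \<and> f ` G \<subseteq> I \<and> (\<forall>k\<in>I. mu i \<le> val i (share f G k))"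

definition feas :: "nat \<Rightarrow> nat \<Rightarrow> nat set \<Rightarrow> bool" where
  "feas i n G \<longleftrightarrow> (\<exists>I f. card I = n \<and> part i I G f)"

text \<open>Goods may stay unassigned, so leftovers never have to be tracked.\<close>

definition sat :: "nat set \<Rightarrow> nat set \<Rightarrow> bool" where
  "sat L G \<longleftrightarrow> (\<exists>A. (\<forall>i\<in>L. A i \<subseteq> G \<and> mu i \<le> val i (A i)) \<and> disjoint_family_on A L)"

section \<open>Values of bundles and changes of one agent's partition\<close>

lemma val_mono: "X \<subseteq> Y \<Longrightarrow> finite Y \<Longrightarrow> val i X \<le> val i Y"
  unfolding val_def by (intro sum_mono2) (auto simp: nonneg)

lemma val_Un: "finite X \<Longrightarrow> finite Y \<Longrightarrow> X \<inter> Y = {} \<Longrightarrow> val i (X \<union> Y) = val i X + val i Y"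
  unfolding val_def by (rule sum.union_disjoint)

lemma val_Diff: "finite Y \<Longrightarrow> X \<subseteq> Y \<Longrightarrow> val i (Y - X) = val i Y - val i X"
  unfolding val_def by (rule sum_diff)

lemma val_image_le:
  assumes "inj_on h X" "\<And>x. x \<in> X \<Longrightarrow> h x \<le> x"
  shows "val i X \<le> val i (h ` X)"
proof -
  have "val i (h ` X) = (\<Sum>x\<in>X. v i (h x))"
    unfolding val_def using assms(1) by (simp add: sum.reindex)
  moreover have "sum (v i) X \<le> (\<Sum>x\<in>X. v i (h x))"
    by (intro sum_mono anti assms(2))
  ultimately show ?thesis by (simp add: val_def)
qed

lemma val_dominates:
  assumes "dominates Y X" "finite Y"
  shows "val i X \<le> val i Y"
proof -
  obtain h where h: "inj_on h X" "h ` X \<subseteq> Y" "\<forall>x\<in>X. h x \<le> x"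
    using assms unfolding dominates_def by blast
  have "val i X \<le> val i (h ` X)" using h by (intro val_image_le) auto
  also have "\<dots> \<le> val i Y" using h(2) assms(2) by (rule val_mono)
  finally show ?thesis .
qed

lemma partD:
  assumes "part i I G f"
  shows "finite I" "finite G" "g \<in> G \<Longrightarrow> f g \<in> I" "k \<in> I \<Longrightarrow> mu i \<le> val i (share f G k)"
    "finite (share f G k)"
  using assms by (auto simp: part_def finite_share)

lemma part_feas: "part i I G f \<Longrightarrow> feas i (card I) G"
  unfolding feas_def by blast

lemma part_sum:
  assumes "finite I" "finite G" "f ` G \<subseteq> I"
  shows "(\<Sum>k\<in>I. sum w (share f G k)) = sum w G"
  using sum.group[OF assms(2,1,3), of w] by (simp add: share_def)

lemma part_card:
  assumes "part i I G f"
  shows "(\<Sum>k\<in>I. card (share f G k)) = card G"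
proof -
  have "(\<Sum>k\<in>I. sum (\<lambda>_. 1::nat) (share f G k)) = sum (\<lambda>_. 1) G"
    using assms by (intro part_sum) (auto simp: part_def)
  then show ?thesis by simp
qed

lemma part_total:
  assumes "part i I G f"
  shows "card I * mu i \<le> val i G"
proof -
  have "card I * mu i = (\<Sum>k\<in>I. mu i)" by simp
  also have "\<dots> \<le> (\<Sum>k\<in>I. val i (share f G k))"
    using assms by (intro sum_mono) (auto simp: part_def)
  also have "\<dots> = val i G"
    unfolding val_def using assms by (intro part_sum) (auto simp: part_def)
  finally show ?thesis .
qed

lemma feas_total: "feas i n G \<Longrightarrow> n * mu i \<le> val i G"
  unfolding feas_def using part_total by auto

text \<open>All goods outside the bundles \<open>Q k\<close> go to \<open>k0\<close>. That the other
  bundles are kept exactly allows later counts of bundles of size two.\<close>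

lemma pack_part:
  assumes "finite G" "finite I" "k0 \<in> I" "\<And>k. k \<in> I \<Longrightarrow> Q k \<subseteq> G"
    "disjoint_family_on Q I" "\<And>k. k \<in> I \<Longrightarrow> mu i \<le> val i (Q k)"
  obtains f where "part i I G f" "\<And>k. k \<in> I \<Longrightarrow> k \<noteq> k0 \<Longrightarrow> share f G k = Q k"
    "Q k0 \<subseteq> share f G k0"
proof -
  define f where "f g = (if \<exists>k\<in>I. g \<in> Q k then SOME k. k \<in> I \<and> g \<in> Q k else k0)" for g
  have f: "f g = k" if "k \<in> I" "g \<in> Q k" for g k
  proof -
    have "f g = (SOME k. k \<in> I \<and> g \<in> Q k)" using that by (auto simp: f_def)
    moreover have "(SOME k. k \<in> I \<and> g \<in> Q k) \<in> I \<and> g \<in> Q (SOME k. k \<in> I \<and> g \<in> Q k)"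
      using that by (intro someI[of "\<lambda>k. k \<in> I \<and> g \<in> Q k"]) auto
    ultimately show ?thesis
      using assms(5) that unfolding disjoint_family_on_def by (metis IntI empty_iff)
  qed
  have f0: "f g = k0" if "\<And>k. k \<in> I \<Longrightarrow> g \<notin> Q k" for g
    using that by (auto simp: f_def)
  have sub: "Q k \<subseteq> share f G k" if "k \<in> I" for k
    using that f assms(4) by (auto simp: share_def)
  have eq: "share f G k = Q k" if "k \<in> I" "k \<noteq> k0" for k
  proof
    show "share f G k \<subseteq> Q k"
    proof
      fix g assume g: "g \<in> share f G k"
      then have "f g = k" by (simp add: share_def)
      with that f0 obtain k' where "k' \<in> I" "g \<in> Q k'" by metis
      with f \<open>f g = k\<close> show "g \<in> Q k" by auto
    qed
  qed (rule sub[OF that(1)])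
  have "f g \<in> I" for g using f f0 assms(3) by metis
  moreover have "mu i \<le> val i (share f G k)" if "k \<in> I" for k
    using assms(6)[OF that] val_mono[OF sub[OF that] finite_share[OF assms(1)]] by (rule order_trans)
  ultimately have "part i I G f"
    using assms(1,2) by (auto simp: part_def)
  then show ?thesis using that eq sub assms(3) by blast
qed

lemma part_drop:
  assumes "part i I G f" "g \<in> G" "k0 \<in> I" "k0 \<noteq> f g"
  obtains f' where "part i (I - {f g}) (G - {g}) f'"
    "\<And>k. k \<in> I \<Longrightarrow> k \<noteq> f g \<Longrightarrow> k \<noteq> k0 \<Longrightarrow> share f' (G - {g}) k = share f G k"
proof -
  have "share f G k \<subseteq> G - {g}" if "k \<in> I - {f g}" for k
    using that by (auto simp: share_def)
  moreover have "disjoint_family_on (share f G) (I - {f g})"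
    by (auto simp: disjoint_family_on_def share_def)
  ultimately obtain f' where "part i (I - {f g}) (G - {g}) f'"
    "\<And>k. k \<in> I - {f g} \<Longrightarrow> k \<noteq> k0 \<Longrightarrow> share f' (G - {g}) k = share f G k"
    using pack_part[of "G - {g}" "I - {f g}" k0 "share f G" i] assms unfolding part_def
    by (metis DiffD1 DiffI finite_Diff singletonD)
  then show ?thesis using that by simp
qed

lemma feas_drop:
  assumes "feas i (Suc n) G" "g \<in> G" "0 < n"
  shows "feas i n (G - {g})"
proof -
  obtain I f where I: "card I = Suc n" "part i I G f" using assms by (auto simp: feas_def)
  have fg: "f g \<in> I" using I assms by (auto simp: part_def)
  then have c: "card (I - {f g}) = n" using I by (simp add: part_def)
  with assms(3) obtain k0 where "k0 \<in> I" "k0 \<noteq> f g" by (metis DiffE card.empty ex_in_conv less_irrefl singletonI)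
  from part_drop[OF I(2) assms(2) this] obtain f' where "part i (I - {f g}) (G - {g}) f'" .
  with c show ?thesis by (auto simp: feas_def)
qed

text \<open>Exchange: bundle \<open>l\<close> is dissolved, and each good of \<open>X\<close> in
  another bundle is replaced by its image in bundle \<open>l\<close>, which is at least as valuable.
  Sizes are preserved except at \<open>k0\<close>, which collects the leftovers.\<close>

lemma part_spare:
  assumes "part j I G f" "l \<in> I" "dominates (share f G l) X" "X \<subseteq> G" "k0 \<in> I" "k0 \<noteq> l"
  obtains f' where "part j (I - {l}) (G - X) f'"
    "\<And>k. k \<in> I \<Longrightarrow> k \<noteq> l \<Longrightarrow> k \<noteq> k0 \<Longrightarrow> card (share f' (G - X) k) = card (share f G k)"
    "card (share f G k0) \<le> card (share f' (G - X) k0)"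
proof -
  let ?Y = "share f G l"
  have fin: "finite G" "finite X" "finite I" "\<And>k. finite (share f G k)"
    using assms by (auto simp: part_def finite_share intro: finite_subset)
  obtain h where h: "inj_on h (X - ?Y)" "h ` (X - ?Y) \<subseteq> ?Y - X" "\<forall>x\<in>X - ?Y. h x \<le> x"
    using dominates_diff[OF assms(3) fin(2) fin(4)] unfolding dominates_def by blast
  define Q where "Q k = (share f G k - X) \<union> h ` (share f G k \<inter> X)" for k
  have sub: "share f G k \<inter> X \<subseteq> X - ?Y" if "k \<noteq> l" for k
    using that by (auto simp: share_def)
  have QY: "h ` (share f G k \<inter> X) \<subseteq> ?Y - X" if "k \<noteq> l" for k
    using sub[OF that] h(2) by blast
  have inj: "inj_on h (share f G k \<inter> X)" if "k \<noteq> l" for k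
    using h(1) sub[OF that] by (rule inj_on_subset)
  have dQ: "(share f G k - X) \<inter> h ` (share f G k \<inter> X) = {}" if "k \<noteq> l" for k
    using QY[OF that] that by (auto simp: share_def)
  have QG: "Q k \<subseteq> G - X" if "k \<in> I - {l}" for k
    using QY[of k] that by (auto simp: Q_def share_def)
  have "disjoint_family_on Q (I - {l})"
    unfolding disjoint_family_on_def
  proof (intro ballI impI)
    fix m n assume mn: "m \<in> I - {l}" "n \<in> I - {l}" "m \<noteq> n"
    have "h ` (share f G m \<inter> X) \<inter> h ` (share f G n \<inter> X) = h ` ((share f G m \<inter> X) \<inter> (share f G n \<inter> X))"
      using h(1) sub[of m] sub[of n] mn by (intro inj_on_image_Int[symmetric]) auto
    also have "\<dots> = {}" using mn by (auto simp: share_def)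
    finally show "Q m \<inter> Q n = {}"
      using QY[of m] QY[of n] mn unfolding Q_def by (auto simp: share_def)
  qed
  moreover have "mu j \<le> val j (Q k)" if k: "k \<in> I - {l}" for k
  proof -
    have "val j (share f G k) = val j ((share f G k - X) \<union> (share f G k \<inter> X))"
      by (rule arg_cong[of _ _ "val j"]) auto
    also have "\<dots> = val j (share f G k - X) + val j (share f G k \<inter> X)"
      using fin by (intro val_Un) auto
    also have "\<dots> \<le> val j (share f G k - X) + val j (h ` (share f G k \<inter> X))"
      using inj[of k] k h(3) sub[of k] by (intro add_left_mono val_image_le) auto
    also have "\<dots> = val j (Q k)"
      unfolding Q_def using fin dQ[of k] k by (intro val_Un[symmetric]) auto
    finally show ?thesis using assms(1) k by (auto simp: part_def intro: order_trans)
  qed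
  ultimately obtain f' where f': "part j (I - {l}) (G - X) f'"
    "\<And>k. k \<in> I - {l} \<Longrightarrow> k \<noteq> k0 \<Longrightarrow> share f' (G - X) k = Q k" "Q k0 \<subseteq> share f' (G - X) k0"
    using pack_part[of "G - X" "I - {l}" k0 Q j] QG assms fin by auto
  have card: "card (Q k) = card (share f G k)" if "k \<noteq> l" for k
  proof -
    have "card (Q k) = card (share f G k - X) + card (share f G k \<inter> X)"
      unfolding Q_def using fin dQ[OF that] inj[OF that] by (subst card_Un_disjoint) (auto simp: card_image)
    then show ?thesis using fin by (simp add: card_Diff_subset_Int card_mono)
  qed
  have "card (Q k0) \<le> card (share f' (G - X) k0)"
    using f'(3) fin by (intro card_mono finite_share) auto
  then show ?thesis using that f' card assms(6) by auto
qed

lemma feas_spare: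
  assumes "part j I G f" "l \<in> I" "dominates (share f G l) X" "X \<subseteq> G" "card I = Suc n" "0 < n"
  shows "feas j n (G - X)"
proof -
  have "card (I - {l}) = n" using assms by (simp add: part_def)
  moreover from this obtain k0 where "k0 \<in> I - {l}" using assms(6) by (metis card.empty ex_in_conv less_irrefl)
  ultimately show ?thesis using part_spare[OF assms(1-4), of k0] part_feas by (metis DiffD1 DiffD2 insertI1)
qed

text \<open>Together the two bundles are worth at least \<open>2 * mu j\<close>, so without
  \<open>X\<close> they still make one good bundle.\<close>

lemma feas_merge:
  assumes "part j I G f" "k \<in> I" "l \<in> I" "k \<noteq> l" "X \<subseteq> share f G k \<union> share f G l" "val j X \<le> mu j"
    "card I = Suc n"
  shows "feas j n (G - X)"
proof -
  define f' where "f' g = (if f g = l then k else f g)" for g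
  have fin: "finite G" "finite I" "\<And>k. finite (share f G k)"
    using assms by (auto simp: part_def finite_share)
  have bk: "share f' (G - X) k = (share f G k \<union> share f G l) - X"
    by (auto simp: share_def f'_def)
  have bm: "share f' (G - X) m = share f G m" if "m \<noteq> k" "m \<noteq> l" for m
    using that assms(5) by (auto simp: share_def f'_def)
  have "val j (share f' (G - X) k) = val j (share f G k) + val j (share f G l) - val j X"
    unfolding bk using assms(4,5) fin by (simp add: val_Diff val_Un share_disjoint)
  then have "mu j \<le> val j (share f' (G - X) k)"
    using partD(4)[OF assms(1,2)] partD(4)[OF assms(1,3)] assms(6) by linarith
  then have "mu j \<le> val j (share f' (G - X) m)" if "m \<in> I - {l}" for m
    using that assms(1) bm[of m] by (cases "m = k") (auto simp: part_def)
  moreover have "f' ` (G - X) \<subseteq> I - {l}"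
    using assms(1,2,4) by (auto simp: f'_def part_def)
  ultimately have "part j (I - {l}) (G - X) f'" using fin by (auto simp: part_def)
  moreover have "card (I - {l}) = n" using assms(3,7) fin by simp
  ultimately show ?thesis by (auto simp: feas_def)
qed

lemma feas_merge_pair:
  assumes "feas j (Suc n) G" "0 < n" "a \<in> G" "b \<in> G" "val j {a, b} \<le> mu j"
  shows "feas j n (G - {a, b})"
proof -
  obtain I f where I: "card I = Suc n" "part j I G f" using assms by (auto simp: feas_def)
  have ab: "f a \<in> I" "f b \<in> I" using I assms by (auto simp: part_def)
  \<comment> \<open>If both goods lie in the same bundle, it is merged with any other one.\<close>
  obtain l where l: "l \<in> I" "l \<noteq> f a" "f b \<noteq> f a \<longrightarrow> l = f b"
  proof (cases "f b = f a")
    case True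
    have "card (I - {f a}) = n" using I ab by (simp add: part_def)
    with assms(2) obtain l where "l \<in> I - {f a}" by (metis card.empty ex_in_conv less_irrefl)
    with True that show ?thesis by auto
  next
    case False with ab that show ?thesis by auto
  qed
  have "{a, b} \<subseteq> share f G (f a) \<union> share f G l"
    using l assms(3,4) by (auto simp: share_def)
  then show ?thesis using feas_merge[OF I(2) ab(1) l(1) l(2)[symmetric] _ assms(5) I(1)] by blast
qed

lemma sat_insert:
  assumes "sat L (G - X)" "X \<subseteq> G" "mu i \<le> val i X"
  shows "sat (insert i L) G"
proof -
  obtain A where A: "\<And>j. j \<in> L \<Longrightarrow> A j \<subseteq> G - X" "\<And>j. j \<in> L \<Longrightarrow> mu j \<le> val j (A j)" "disjoint_family_on A L"
    using assms(1) unfolding sat_def by blast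
  define B where "B = A(i := X)"
  have "disjoint_family_on B (insert i L)"
    unfolding disjoint_family_on_def
  proof (intro ballI impI)
    fix m n assume "m \<in> insert i L" "n \<in> insert i L" "m \<noteq> n"
    then show "B m \<inter> B n = {}"
      using A(1)[of m] A(1)[of n] A(3) unfolding B_def disjoint_family_on_def
      by (cases "m = i"; cases "n = i") auto
  qed
  moreover have "B j \<subseteq> G \<and> mu j \<le> val j (B j)" if "j \<in> insert i L" for j
    using A(1,2)[of j] assms(2,3) that unfolding B_def by (cases "j = i") auto
  ultimately show ?thesis unfolding sat_def by blast
qed

lemma sat_mono: "sat L G \<Longrightarrow> G \<subseteq> G' \<Longrightarrow> sat L G'"
  unfolding sat_def by blast

lemma sat_single: "mu i \<le> val i G \<Longrightarrow> sat {i} G"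
  unfolding sat_def disjoint_family_on_def by (intro exI[of _ "\<lambda>_. G"]) auto

text \<open>Cut and choose: \<open>j\<close> accepts either part of her own division, and one part
  is worth at least half of the total to \<open>k\<close>.\<close>

lemma sat_cut_choose:
  assumes "feas j 2 G" "j \<noteq> k" "2 * mu k \<le> val k G"
  shows "sat {j, k} G"
proof -
  obtain I f where I: "card I = 2" "part j I G f" using assms by (auto simp: feas_def)
  then obtain a b where ab: "I = {a, b}" "a \<noteq> b" by (meson card_2_iff)
  have fin: "finite G" using I by (simp add: part_def)
  have G: "G = share f G a \<union> share f G b" using I ab by (auto simp: part_def share_def)
  have dis: "share f G a \<inter> share f G b = {}" using ab by (simp add: share_disjoint)
  have "val k G = val k (share f G a) + val k (share f G b)"
    by (subst G, rule val_Un) (auto simp: finite_share fin dis)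
  then consider "mu k \<le> val k (share f G a)" | "mu k \<le> val k (share f G b)"
    using assms(3) by linarith
  then show ?thesis
  proof cases
    case 1
    have "mu j \<le> val j (share f G b)" using I ab by (auto simp: part_def)
    moreover have "share f G b \<subseteq> G - share f G a" using dis share_subset by blast
    ultimately have "sat {j} (G - share f G a)" by (metis sat_single sat_mono)
    from sat_insert[OF this share_subset 1] show ?thesis by (simp add: insert_commute)
  next
    case 2
    have "mu j \<le> val j (share f G a)" using I ab by (auto simp: part_def)
    moreover have "share f G a \<subseteq> G - share f G b" using dis share_subset by blast
    ultimately have "sat {j} (G - share f G b)" by (metis sat_single sat_mono)
    from sat_insert[OF this share_subset 2] show ?thesis by (simp add: insert_commute)
  qed
qed

end

subsection \<open>Three agents\<close>

lemma finite_enum: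
  assumes "finite (G :: nat set)"
  obtains e where "strict_mono_on {..<card G} e" "e ` {..<card G} = G"
proof
  let ?e = "\<lambda>k. sorted_list_of_set G ! k"
  show "strict_mono_on {..<card G} ?e"
    using sorted_wrt_nth_less[OF strict_sorted_list_of_set, of _ _ G]
    by (intro strict_mono_onI) (simp add: assms)
  have "set (sorted_list_of_set G) = ?e ` {..<card G}"
    unfolding set_conv_nth using assms by auto
  then show "?e ` {..<card G} = G" using assms by simp
qed

lemma pigeonhole_pair:
  assumes "finite B" "f ` A \<subseteq> B" "card B < card A"
  obtains x y where "x \<in> A" "y \<in> A" "x < y" "f x = f (y :: nat)"
proof -
  have "\<not> inj_on f A" using assms card_inj_on_le[of f A B] by linarith
  then obtain x y where "x \<in> A" "y \<in> A" "x \<noteq> y" "f x = f y" unfolding inj_on_def by blast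
  then show ?thesis using that by (metis linorder_neqE)
qed

lemma card3E:
  assumes "card S = 3" "a \<in> S" "b \<in> S" "a \<noteq> b"
  obtains c where "S = {a, b, c}" "c \<noteq> a" "c \<noteq> b"
proof -
  have "finite S" using assms(1) by (metis card.infinite zero_neq_numeral)
  then have "card (S - {a, b}) = 1" using assms by (simp add: card_Diff_subset)
  then obtain c where "S - {a, b} = {c}" by (rule card_1_singletonE)
  then show ?thesis using that[of c] assms by auto
qed

lemma card3_sorted:
  assumes "card (S :: nat set) = 3" "m \<in> S" "\<And>x. x \<in> S \<Longrightarrow> m \<le> x"
  obtains s t where "S = {m, s, t}" "m < s" "s < t"
proof -
  have "finite S" using assms(1) by (metis card.infinite zero_neq_numeral)
  then have "card (S - {m}) = 2" using assms by simp
  then obtain s t where st: "S - {m} = {s, t}" "s \<noteq> t" by (meson card_2_iff)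
  then have S: "S = {m, s, t}" "s \<noteq> m" "t \<noteq> m" using assms(2) by auto
  with assms(3) have "m < s" "m < t" by (auto simp: order_le_less)
  then show ?thesis using that[of s t] that[of t s] S st(2) by (cases "s < t") auto
qed

text \<open>Words of length three, any two agreeing in exactly one position. If three words share
  the first letter, a word with another first letter agrees with each of them in the second or third
  letter, hence two of the three agree once more; if no such word exists, the five second letters
  are all different.\<close>

lemma code_words_bound:
  fixes t y z :: "nat \<Rightarrow> nat"
  assumes "card W = 5" "card (t ` W) \<le> 3" "card (y ` W) \<le> 4"
    and agree: "\<And>u w. u \<in> W \<Longrightarrow> w \<in> W \<Longrightarrow> u \<noteq> w \<Longrightarrow>
      (t u = t w \<and> y u \<noteq> y w \<and> z u \<noteq> z w) \<or> (t u \<noteq> t w \<and> y u = y w \<and> z u \<noteq> z w) \<or>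
      (t u \<noteq> t w \<and> y u \<noteq> y w \<and> z u = z w)"
  shows False
proof -
  have fin: "finite W" using assms(1) by (metis card.infinite zero_neq_numeral)
  have fibre: False if w: "a \<in> W" "b \<in> W" "c \<in> W" "a \<noteq> b" "a \<noteq> c" "b \<noteq> c" "t a = t b" "t a = t c" for a b c
  proof (cases "\<exists>d\<in>W. t d \<noteq> t a")
    case True
    then obtain d where d: "d \<in> W" "t d \<noteq> t a" by blast
    then show False using agree[of a b] agree[of a c] agree[of b c] agree[of a d] agree[of b d] agree[of c d] w
      by metis
  next
    case False
    then have "inj_on y W" using agree unfolding inj_on_def by metis
    then show False using assms(1,3) by (simp add: card_image)
  qed
  \<comment> \<open>So the first letters are distributed as 2 + 2 + 1. The two pairs
    \<open>a, b\<close> and \<open>c, d\<close> agree crosswise in the other letters, which forces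
    the fifth word to agree twice with \<open>c\<close> or with \<open>d\<close>.\<close>
  obtain a b where ab: "a \<in> W" "b \<in> W" "a \<noteq> b" "t a = t b"
    using pigeonhole_pair[of "t ` W" t W] fin assms(1,2) by (metis finite_imageI le_less_trans nat_neq_iff numeral_less_iff order_refl semiring_norm(76) semiring_norm(78) semiring_norm(80) semiring_norm(81))
  have "t ` (W - {a, b}) \<subseteq> t ` W - {t a}" using fibre ab by blast
  moreover have "card (t ` W - {t a}) \<le> 2" using ab fin assms(2) by simp
  moreover have "card (W - {a, b}) = 3" using ab fin assms(1) by (simp add: card_Diff_subset)
  ultimately obtain c d where cd: "c \<in> W - {a, b}" "d \<in> W - {a, b}" "c \<noteq> d" "t c = t d"
    using pigeonhole_pair[of "t ` W - {t a}" t "W - {a, b}"] fin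
    by (metis finite_Diff finite_imageI le_less_trans lessI nat_neq_iff numeral_3_eq_3 numeral_2_eq_2)
  have "card {a, b, c, d} = 4" using ab cd by auto
  then have "W \<noteq> {a, b, c, d}" using assms(1) by auto
  then obtain w where w: "w \<in> W" "w \<notin> {a, b, c, d}" using ab cd by blast
  have "t c \<noteq> t a" using fibre[of a b c] ab cd by auto
  moreover have "t w \<noteq> t a" using fibre[of a b w] ab w by auto
  moreover have "t w \<noteq> t c" using fibre[of c d w] cd w by auto
  ultimately show False
    using agree[of a b] agree[of c d] agree[of a c] agree[of a d] agree[of b c] agree[of b d]
      agree[of a w] agree[of b w] agree[of c w] agree[of d w] ab cd w by (metis DiffD1 insert_iff)
qed

text \<open>A family to be refuted or bounded in size. It may have more than three agents, because
  more partitions on the same goods give more contradictions. The partitions are parameters, so that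
  ones with special bundle sizes can be supplied.\<close>

locale unsat3 = ordered_goods +
  fixes A G :: "nat set" and I :: "nat \<Rightarrow> nat set" and f :: "nat \<Rightarrow> nat \<Rightarrow> nat"
  assumes agents: "finite A" "3 \<le> card A"
    and parts: "i \<in> A \<Longrightarrow> part i (I i) G (f i)"
    and three: "i \<in> A \<Longrightarrow> card (I i) = 3"
    and unsat: "L \<subseteq> A \<Longrightarrow> card L = 3 \<Longrightarrow> \<not> sat L G"
    and nonempty: "G \<noteq> {}"
begin

abbreviation "B i k \<equiv> share (f i) G k"

lemma finG: "finite G"
  using agents parts by (metis card.empty ex_in_conv not_numeral_le_zero partD(2))

lemma unsat': "i \<in> A \<Longrightarrow> j \<in> A \<Longrightarrow> k \<in> A \<Longrightarrow> i \<noteq> j \<Longrightarrow> i \<noteq> k \<Longrightarrow> j \<noteq> k \<Longrightarrow> \<not> sat {i, j, k} G"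
  using unsat[of "{i, j, k}"] by simp

lemma third:
  assumes "i \<in> A" "j \<in> A"
  obtains k where "k \<in> A" "k \<noteq> i" "k \<noteq> j"
proof -
  have "card {i, j} < card A" using agents(2) card_insert_le_m1[of 2 "{j}" i] by (simp add: card_insert_if)
  then have "\<not> A \<subseteq> {i, j}" using card_mono[of "{i, j}" A] by auto
  then show ?thesis using that by blast
qed

lemma feas3: "i \<in> A \<Longrightarrow> feas i 3 G"
  using parts three part_feas by metis

lemma total: "i \<in> A \<Longrightarrow> 3 * mu i \<le> val i G"
  using feas_total[OF feas3] by simp

text \<open>The basic move: \<open>i\<close> leaves with \<open>X\<close>, \<open>j\<close> cuts the
  rest, \<open>k\<close> chooses.\<close>

lemma cut_after:
  assumes "i \<in> A" "j \<in> A" "k \<in> A" "i \<noteq> j" "i \<noteq> k" "j \<noteq> k" "X \<subseteq> G"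
    and "mu i \<le> val i X" "feas j 2 (G - X)" "2 * mu k \<le> val k (G - X)"
  shows False
  using sat_insert[OF sat_cut_choose[OF assms(9,6,10)] assms(7,8)] unsat'[OF assms(1-6)] by blast

text \<open>The owner of a smaller bundle would be content with the best good. Its removal costs
  each other agent only one bundle, and cut and choose finishes.\<close>

lemma share_ge2:
  assumes "i \<in> A" "c \<in> I i"
  shows "2 \<le> card (B i c)"
proof (rule ccontr)
  assume "\<not> ?thesis"
  then have c: "card (B i c) \<le> 1" by simp
  let ?m = "Min G"
  have m: "?m \<in> G" "\<And>g. g \<in> G \<Longrightarrow> ?m \<le> g" using finG nonempty by auto
  have "val i (B i c) \<le> val i {?m}"
  proof (cases "B i c = {}")
    case True then show ?thesis by (simp add: val_def nonneg)
  next
    case False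
    then obtain x where "B i c = {x}" using c finG
      by (metis card_1_singletonE card_0_eq finite_share le_SucE le_zero_eq One_nat_def)
    moreover then have "x \<in> G" using share_subset by blast
    ultimately show ?thesis using anti[OF m(2)] by (simp add: val_def)
  qed
  then have i: "mu i \<le> val i {?m}" using partD(4)[OF parts assms(2)] assms(1) by fastforce
  obtain j where j: "j \<in> A" "j \<noteq> i" using third assms(1) by blast
  obtain k where k: "k \<in> A" "k \<noteq> i" "k \<noteq> j" using third assms(1) j(1) by blast
  have "feas l 2 (G - {?m})" if "l \<in> A" for l
    using feas_drop[of l 2 G ?m] feas3[OF that] m by (simp add: numeral_3_eq_3 numeral_2_eq_2)
  then show False
    using cut_after[of i j k "{?m}"] feas_total[of k 2 "G - {?m}"] assms(1) i j k m(1) by auto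
qed

text \<open>Averaging: three bundles below \<open>mu j\<close> cannot add up to
  \<open>3 * mu j\<close>.\<close>

lemma accepts_some:
  assumes "i \<in> A" "j \<in> A"
  obtains c where "c \<in> I i" "mu j \<le> val j (B i c)"
proof -
  have "\<not> (\<forall>c\<in>I i. val j (B i c) < mu j)"
  proof
    assume "\<forall>c\<in>I i. val j (B i c) < mu j"
    moreover have "I i \<noteq> {}" "finite (I i)" using three[OF assms(1)] by (auto intro: card_ge_0_finite)
    ultimately have "(\<Sum>c\<in>I i. val j (B i c)) < (\<Sum>c\<in>I i. mu j)"
      by (intro sum_strict_mono) auto
    moreover have "(\<Sum>c\<in>I i. val j (B i c)) = val j G"
      unfolding val_def using parts[OF assms(1)] by (intro part_sum) (auto simp: part_def)
    ultimately show False using total[OF assms(2)] three[OF assms(1)] by simp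
  qed
  then show ?thesis using that by (meson not_less)
qed

text \<open>Otherwise \<open>j\<close> and \<open>k\<close> take the two different bundles and
  \<open>i\<close> the third.\<close>

lemma accept_same:
  assumes "i \<in> A" "j \<in> A" "k \<in> A" "i \<noteq> j" "i \<noteq> k" "j \<noteq> k"
    "c \<in> I i" "d \<in> I i" "mu j \<le> val j (B i c)" "mu k \<le> val k (B i d)"
  shows "c = d"
proof (rule ccontr)
  assume "c \<noteq> d"
  then obtain b where b: "I i = {c, d, b}" "b \<noteq> c" "b \<noteq> d" using card3E[OF three[OF assms(1)] assms(7,8)] by blast
  then have i: "mu i \<le> val i (B i b)" using partD(4)[OF parts[OF assms(1)]] by blast
  have "sat {i} (G - B i c - B i d)"
    by (rule sat_mono[OF sat_single[OF i]]) (use b in \<open>auto simp: share_def\<close>)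
  then have "sat {k, i} (G - B i c)"
    by (rule sat_insert) (use assms \<open>c \<noteq> d\<close> in \<open>auto simp: share_def\<close>)
  then have "sat {j, k, i} G"
    by (rule sat_insert) (use assms in \<open>auto simp: share_def\<close>)
  then show False using unsat'[of j k i] assms by auto
qed

lemma ex_common:
  assumes "i \<in> A"
  shows "\<exists>b\<in>I i. \<forall>c\<in>I i - {b}. \<forall>j\<in>A - {i}. val j (B i c) < mu j"
proof -
  obtain j where j: "j \<in> A" "j \<noteq> i" using third assms by blast
  obtain k where k: "k \<in> A" "k \<noteq> i" "k \<noteq> j" using third assms j(1) by blast
  obtain b where b: "b \<in> I i" "mu j \<le> val j (B i b)" using accepts_some assms j(1) by blast
  obtain d where d: "d \<in> I i" "mu k \<le> val k (B i d)" using accepts_some assms k(1) by blast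
  have "c = b" if "c \<in> I i" "l \<in> A - {i}" "mu l \<le> val l (B i c)" for c l
  proof (cases "l = j")
    case True
    then show ?thesis using accept_same[of i j k c d] accept_same[of i j k b d] that assms j k b d by auto
  next
    case False
    then show ?thesis using accept_same[of i l j c b] that assms j b by auto
  qed
  then show ?thesis using b(1) by (intro bexI[of _ b]) (auto simp: not_le[symmetric])
qed

text \<open>All acceptances of bundles of agent \<open>i\<close> by other agents fall on a single bundle \<open>com i\<close>.\<close>
definition com :: "nat \<Rightarrow> nat" where
  "com i = (SOME b. b \<in> I i \<and> (\<forall>c\<in>I i - {b}. \<forall>j\<in>A - {i}. val j (B i c) < mu j))"

lemma com:
  assumes "i \<in> A"
  shows "com i \<in> I i" "c \<in> I i \<Longrightarrow> c \<noteq> com i \<Longrightarrow> j \<in> A \<Longrightarrow> j \<noteq> i \<Longrightarrow> val j (B i c) < mu j"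
  using someI_ex[of "\<lambda>b. b \<in> I i \<and> (\<forall>c\<in>I i - {b}. \<forall>j\<in>A - {i}. val j (B i c) < mu j)"] ex_common[OF assms]
  unfolding com_def by (blast, blast)

lemma val_rest:
  assumes "k \<in> A" "X \<subseteq> G" "val k X \<le> mu k"
  shows "2 * mu k \<le> val k (G - X)"
  using total[OF assms(1)] assms(2,3) finG by (simp add: val_Diff)

text \<open>Otherwise \<open>i\<close> takes \<open>B i c\<close>, agent \<open>j\<close> merges the bundles that this damages, and a third
  agent \<open>k\<close>, who rejects \<open>B i c\<close>, chooses between the two bundles of \<open>j\<close>.\<close>
lemma meet:
  assumes "i \<in> A" "j \<in> A" "i \<noteq> j" "c \<in> I i" "c \<noteq> com i" "d \<in> I j"
  shows "B i c \<inter> B j d \<noteq> {}"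
proof
  assume empty: "B i c \<inter> B j d = {}"
  obtain k where k: "k \<in> A" "k \<noteq> i" "k \<noteq> j" using third assms(1,2) by blast
  have "card (I j - {d}) = 2" using three[OF assms(2)] assms(6) by simp
  then obtain p q where pq: "I j - {d} = {p, q}" "p \<noteq> q" by (meson card_2_iff)
  have "B i c \<subseteq> B j p \<union> B j q"
  proof
    fix x assume x: "x \<in> B i c"
    then have "x \<in> G" using share_subset by blast
    then have "f j x \<in> I j" "x \<in> B j (f j x)" using partD(3)[OF parts[OF assms(2)]] by (auto simp: share_def)
    moreover then have "f j x \<noteq> d" using x empty by auto
    ultimately show "x \<in> B j p \<union> B j q" using pq(1) by (metis Diff_iff UnI1 UnI2 insert_iff singletonD)
  qed
  then have "feas j 2 (G - B i c)"
    using feas_merge[OF parts[OF assms(2)], of p q "B i c" 2] pq com(2)[OF assms(1,4,5,2)] assms(3) three[OF assms(2)]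
    by auto
  moreover have "2 * mu k \<le> val k (G - B i c)"
    using val_rest[OF k(1) share_subset] com(2)[OF assms(1,4,5) k(1,2)] by fastforce
  ultimately show False
    using cut_after[of i j k "B i c"] assms k share_subset partD(4)[OF parts[OF assms(1)] assms(4)] by blast
qed

text \<open>Under dominance \<open>j\<close> could spare a bundle for \<open>B i k\<close>. If a
  third agent \<open>m\<close> values \<open>B i k\<close> at most at \<open>mu m\<close>, then
  \<open>i\<close> takes it, \<open>j\<close> cuts and \<open>m\<close> chooses. Otherwise
  \<open>m\<close> takes it, \<open>j\<close> cuts, and \<open>i\<close>, whose other two bundles
  are intact, chooses.\<close>

lemma incomparable:
  assumes "i \<in> A" "j \<in> A" "i \<noteq> j" "k \<in> I i" "l \<in> I j"
  shows "\<not> dominates (B j l) (B i k)"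
proof
  assume dom: "dominates (B j l) (B i k)"
  let ?X = "B i k"
  obtain m where m: "m \<in> A" "m \<noteq> i" "m \<noteq> j" using third assms(1,2) by blast
  have feas: "feas j 2 (G - ?X)"
    using feas_spare[OF parts[OF assms(2)] assms(5) dom share_subset] three[OF assms(2)] by simp
  show False
  proof (cases "val m ?X \<le> mu m")
    case True
    then show False
      using cut_after[of i j m ?X] feas val_rest[OF m(1) share_subset True] assms m share_subset
        partD(4)[OF parts[OF assms(1)] assms(4)] by blast
  next
    case False
    have "share (f i) (G - ?X) c = B i c" if "c \<noteq> k" for c using that by (auto simp: share_def)
    then have "part i (I i - {k}) (G - ?X) (f i)"
      using parts[OF assms(1)] unfolding part_def by (auto simp: share_def)
    from part_total[OF this] have "2 * mu i \<le> val i (G - ?X)"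
      using three[OF assms(1)] assms(4) by simp
    then show False using cut_after[of m j i ?X] False feas assms m share_subset by fastforce
  qed
qed

lemma noncom_surj:
  assumes "i \<in> A" "j \<in> A" "i \<noteq> j" "c \<in> I i" "c \<noteq> com i"
  shows "f j ` B i c = I j"
proof
  show "f j ` B i c \<subseteq> I j" using parts[OF assms(2)] share_subset by (fastforce simp: part_def)
  show "I j \<subseteq> f j ` B i c" using meet[OF assms] by (fastforce simp: share_def)
qed

lemma two_others:
  assumes "i \<in> A"
  obtains c d where "c \<noteq> d" "I i = {com i, c, d}" "c \<noteq> com i" "d \<noteq> com i"
proof -
  have "card (I i - {com i}) = 2" using three[OF assms] com(1)[OF assms] by simp
  then obtain c d where "I i - {com i} = {c, d}" "c \<noteq> d" by (meson card_2_iff)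
  then show ?thesis using that[of c d] com(1)[OF assms] by blast
qed

text \<open>Otherwise the pair is no better than the third and fourth best goods, while two of the
  best four goods share a bundle of another agent, which then dominates the pair.\<close>

lemma pair_top:
  assumes e: "strict_mono_on {..<card G} e" "e ` {..<card G} = G"
    and "i \<in> A" "k \<in> I i" "B i k = {p, x}" "p < x"
  shows "p = e 0 \<or> p = e 1"
proof (rule ccontr)
  assume np: "\<not> ?thesis"
  obtain j where j: "j \<in> A" "j \<noteq> i" using third assms(3) by blast
  have "p \<in> G" "x \<in> G" using assms(5) share_subset by blast+
  then obtain m n where m: "m < card G" "p = e m" and n: "n < card G" "x = e n" using e(2) by blast
  have "m < n" using m n assms(6) strict_mono_on_less[OF e(1)] by simp
  moreover have "2 \<le> m" using np m by (metis One_nat_def Suc_1 less_2_cases not_less)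
  ultimately have mn: "2 \<le> m" "3 \<le> n" by auto
  have inj: "inj_on e {..<card G}" using e(1) by (rule strict_mono_on_imp_inj_on)
  have "card (e ` {..<4}) = 4"
    using inj n(1) mn(2) by (subst card_image) (auto intro: inj_on_subset)
  moreover have "e ` {..<4} \<subseteq> G" using e(2) n(1) mn(2) by fastforce
  ultimately obtain y z where yz: "y \<in> e ` {..<4}" "z \<in> e ` {..<4}" "y < z" "f j y = f j z"
    using pigeonhole_pair[of "I j" "f j" "e ` {..<4}"] three[OF j(1)] parts[OF j(1)] unfolding part_def
    by (metis image_mono lessI numeral_3_eq_3 eval_nat_numeral(2) subset_trans semiring_norm(26) semiring_norm(27) numeral_eq_Suc pred_numeral_simps(2) semiring_norm(28))
  obtain a b where ab: "a < 4" "y = e a" "b < 4" "z = e b" using yz by auto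
  have "a < b" using yz(3) ab n(1) mn strict_mono_on_less[OF e(1)] by simp
  have mono: "e u \<le> e w" if "u \<le> w" "w < card G" for u w
    using that strict_mono_on_leD[OF e(1)] by simp
  have "y \<le> p" using ab m mn \<open>a < b\<close> mono[of a m] by simp
  moreover have "z \<le> x" using ab n mn mono[of b n] by simp
  ultimately have "dominates (B j (f j y)) {p, x}"
    using yz ab n mn e(2) assms(6) by (intro dominates_pair[of y _ z]) (auto simp: share_def)
  moreover have "f j y \<in> I j"
    using partD(3)[OF parts[OF j(1)]] yz(1) \<open>e ` {..<4} \<subseteq> G\<close> by blast
  ultimately show False using incomparable[of i j k "f j y"] assms j by simp
qed

text \<open>With equal better goods the two pairs are comparable. Otherwise their better goods are
  the best two by \<open>pair_top\<close>, and a bundle of a third agent dominates one of the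
  pairs.\<close>

lemma one_pair_agent:
  assumes "i \<in> A" "j \<in> A" "i \<noteq> j" "k \<in> I i" "l \<in> I j" "card (B i k) = 2" "card (B j l) = 2"
  shows False
proof -
  obtain e where e: "strict_mono_on {..<card G} e" "e ` {..<card G} = G" using finite_enum[OF finG] by blast
  have sorted: "\<exists>p x. S = {p, x} \<and> p < x" if "card S = 2" for S :: "nat set"
    using that by (metis card_2_iff insert_commute linorder_neqE_nat)
  obtain p x where px: "B i k = {p, x}" "p < x" using sorted[OF assms(6)] by blast
  obtain q y where qy: "B j l = {q, y}" "q < y" using sorted[OF assms(7)] by blast
  have pG: "p \<in> G" "x \<in> G" "q \<in> G" "y \<in> G" using px qy share_subset by blast+
  \<comment> \<open>Both rejected bundles of a third agent \<open>m\<close> meet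
    \<open>{p, x}\<close>, so one of them contains \<open>p\<close>. It also contains
    \<open>q\<close> or \<open>y\<close>, neither of which is worse than \<open>x\<close>, and so it
    dominates \<open>{p, x}\<close>.\<close>
  have key: False
    if i: "i \<in> A" "j \<in> A" "i \<noteq> j" "k \<in> I i" "l \<in> I j" "B i k = {p, x}" "B j l = {q, y}" "p < x" "q < y" "p < q"
      and le: "q \<le> x" for i j k l p x q y
  proof -
    have "\<not> x \<le> y"
      using incomparable[of j i l k] dominates_pair[of p "{p, x}" x q y] i by auto
    then have "y < x" by simp
    obtain m where m: "m \<in> A" "m \<noteq> i" "m \<noteq> j" using third i(1,2) by blast
    obtain c d where cd: "c \<noteq> d" "I m = {com m, c, d}" "c \<noteq> com m" "d \<noteq> com m" using two_others[OF m(1)] by blast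
    have "\<exists>u\<in>{c, d}. p \<in> B m u"
      using meet[of m i c k] meet[of m i d k] m i cd by (auto simp: share_def)
    then obtain u where u: "u \<in> I m" "u \<noteq> com m" "p \<in> B m u" using cd by blast
    then have "q \<in> B m u \<or> y \<in> B m u" using meet[of m j u l] m i by auto
    then have "dominates (B m u) {p, x}"
      using u(3) i le \<open>y < x\<close> by (auto intro: dominates_pair)
    then show False using incomparable[of i m k u] i m u by simp
  qed
  have e0: "e 0 \<le> g" if gG: "g \<in> G" for g
  proof -
    obtain n where "n < card G" "g = e n" using gG e(2) by blast
    then show ?thesis using strict_mono_on_leD[OF e(1), of 0 n] by simp
  qed
  have e1: "e 1 \<le> g" if gG: "g \<in> G" "g \<noteq> e 0" for g
  proof -
    obtain n where "n < card G" "g = e n" using gG(1) e(2) by blast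
    with gG(2) show ?thesis using strict_mono_on_leD[OF e(1), of 1 n] by (cases n) auto
  qed
  have p: "p = e 0 \<or> p = e 1" using pair_top[OF e assms(1,4) px] .
  have q: "q = e 0 \<or> q = e 1" using pair_top[OF e assms(2,5) qy] .
  consider "p = q" | "p < q" | "q < p" by linarith
  then show False
  proof cases
    case 1
    then show False
      using incomparable[of i j k l] incomparable[of j i l k] assms px qy
        dominates_pair[of p "{p, x}" x p y] dominates_pair[of p "{p, y}" y p x]
      by (cases "x \<le> y") auto
  next
    case 2
    then have "q \<le> x" using q p e0 e1 pG px by (metis leD less_imp_neq)
    then show False using key[of i j k l p x q y] 2 assms px qy by blast
  next
    case 3
    then have "p \<le> y" using q p e0 e1 pG qy by (metis leD less_imp_neq)
    then show False using key[of j i l k q y p x] 3 assms px qy by blast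
  qed
qed

text \<open>Let \<open>{e 0, e s, e t}\<close> be the bundle with the best good. If
  \<open>t \<le> 6\<close>, it dominates a bundle of another agent, namely one that contains two of
  the four worst goods. So \<open>t\<close> is 7 or 8, two of the three agents agree in
  \<open>t\<close>, and comparing \<open>s\<close> makes their bundles comparable.\<close>

lemma nine_triples:
  assumes "card G = 9" "T \<subseteq> A" "card T = 3" "\<And>i c. i \<in> T \<Longrightarrow> c \<in> I i \<Longrightarrow> card (B i c) = 3"
  shows False
proof -
  obtain e where e: "strict_mono_on {..<9::nat} e" "e ` {..<9} = G" using finite_enum[OF finG] unfolding assms(1) .
  have mono: "e u \<le> e w \<longleftrightarrow> u \<le> w" if "u < 9" "w < 9" for u w
    using that strict_mono_on_less_eq[OF e(1)] by simp
  have less: "e u < e w \<longleftrightarrow> u < w" if "u < 9" "w < 9" for u w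
    using that strict_mono_on_less[OF e(1)] by simp
  have ex: "\<exists>s t. B i (f i (e 0)) = {e 0, e s, e t} \<and> 0 < s \<and> s < t \<and> (t = 7 \<or> t = 8)" if iT: "i \<in> T" for i
  proof -
    have iA: "i \<in> A" using iT assms(2) by blast
    have e0: "e 0 \<in> G" using e by force
    have c: "f i (e 0) \<in> I i" using partD(3)[OF parts[OF iA] e0] .
    have "e 0 \<le> g" if "g \<in> B i (f i (e 0))" for g
      using that e mono[of 0] by (force simp: share_def)
    then obtain s' t' where st': "B i (f i (e 0)) = {e 0, s', t'}" "e 0 < s'" "s' < t'"
      using card3_sorted[OF assms(4)[OF iT c], of "e 0"] e0 by (auto simp: share_def)
    then have "s' \<in> G" "t' \<in> G" by (auto simp: share_def)
    then obtain s t where st: "s < 9" "t < 9" "s' = e s" "t' = e t" using e(2) by blast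
    have lt: "0 < s" "s < t" using st st' less[of 0 s] less[of s t] by auto
    have "\<not> t \<le> 6"
    proof
      assume t6: "t \<le> 6"
      obtain j where j: "j \<in> T" "j \<noteq> i"
        using assms(3) iT card_mono[of "{i}" T] by (metis card.empty card_insert_disjoint empty_iff empty_subsetI finite.emptyI finite_insert One_nat_def numeral_le_one_iff semiring_norm(70) subsetI insertCI)
      have jA: "j \<in> A" using j assms(2) by blast
      have sub: "e ` {5..<9} \<subseteq> G" using e by force
      have "card (e ` {5..<9}) = 4"
        using strict_mono_on_imp_inj_on[OF e(1)] by (subst card_image) (auto intro: inj_on_subset)
      then obtain y z where yz: "y \<in> e ` {5..<9}" "z \<in> e ` {5..<9}" "y < z" "f j y = f j z"
        using pigeonhole_pair[of "I j" "f j" "e ` {5..<9}"] three[OF jA] parts[OF jA] sub unfolding part_def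
        by (metis image_mono lessI numeral_3_eq_3 eval_nat_numeral(2) subset_trans semiring_norm(26) semiring_norm(27) numeral_eq_Suc pred_numeral_simps(2) semiring_norm(28))
      then obtain a b where ab: "5 \<le> a" "a < 9" "y = e a" "5 \<le> b" "b < 9" "z = e b" by auto
      then have "a < b" using yz less by simp
      let ?l = "f j y"
      have l: "?l \<in> I j" "y \<in> B j ?l" "z \<in> B j ?l"
        using yz sub partD(3)[OF parts[OF jA]] by (auto simp: share_def)
      then obtain w where w: "B j ?l = {y, z, w}" "w \<noteq> y" "w \<noteq> z"
        using card3E[OF assms(4)[OF j(1) l(1)] l(2,3)] yz(3) by blast
      then have "w \<in> G" by (auto simp: share_def)
      then have "e 0 \<le> w" using e mono[of 0] by force
      moreover have "e s \<le> y" "e t \<le> z" using ab st lt t6 \<open>a < b\<close> by (simp_all add: mono)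
      ultimately have "dominates {e 0, e s, e t} {w, y, z}"
        using st' st w yz(3) by (intro dominates_triple[of "e 0" "e s" "e t"]) auto
      moreover have "{w, y, z} = B j ?l" using w by auto
      ultimately show False
        using incomparable[of j i ?l "f i (e 0)"] j jA iA l c st' st by simp
    qed
    then show ?thesis using st st' lt by (intro exI[of _ s] exI[of _ t]) auto
  qed
  then obtain s t where st: "\<And>i. i \<in> T \<Longrightarrow> B i (f i (e 0)) = {e 0, e (s i), e (t i)}"
    "\<And>i. i \<in> T \<Longrightarrow> 0 < s i" "\<And>i. i \<in> T \<Longrightarrow> s i < t i" "\<And>i. i \<in> T \<Longrightarrow> t i = 7 \<or> t i = 8" by metis
  have "t ` T \<subseteq> {7, 8}" using st(4) by auto
  then obtain i j where ij: "i \<in> T" "j \<in> T" "i < j" "t i = t j"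
    using pigeonhole_pair[OF _ \<open>t ` T \<subseteq> {7, 8}\<close>] assms(3) by (metis card_2_iff finite.emptyI finite_insert lessI num.simps(6) numeral_3_eq_3 numeral_2_eq_2 numeral_eq_iff semiring_norm(87) semiring_norm(89))
  have key: "dominates (B i (f i (e 0))) (B j (f j (e 0)))" if "i \<in> T" "j \<in> T" "t i = t j" "s i \<le> s j" for i j
  proof -
    have b: "s i < 9" "s j < 9" "t i < 9" "t j < 9" using st(3,4) that by force+
    show ?thesis
      unfolding st(1)[OF that(1)] st(1)[OF that(2)]
      using b that st(2,3)[OF that(1)] st(2,3)[OF that(2)]
      by (intro dominates_triple[of "e 0" "e (s i)" "e (t i)"])
        (auto simp: mono less order.strict_iff_not[symmetric] dest: less[THEN iffD2, THEN less_imp_neq, rotated 2] simp del: not_le intro!: less_imp_neq)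
  qed
  have c: "f i (e 0) \<in> I i" if "i \<in> T" for i
    using partD(3)[OF parts, of i "e 0"] that assms(2) e by force
  show False
    using key[of i j] key[of j i] incomparable[of i j "f i (e 0)" "f j (e 0)"]
      incomparable[of j i "f j (e 0)" "f i (e 0)"] c ij assms(2)
    by (cases "s i \<le> s j") auto
qed

section \<open>Bounds on the number of agents by the number of goods\<close>

lemma share_sum: "i \<in> A \<Longrightarrow> (\<Sum>c\<in>I i. card (B i c)) = card G"
  using part_card[OF parts] .

text \<open>Fix \<open>j\<close>. By \<open>meet\<close> a rejected triple of another agent contains one good of each
  bundle of \<open>j\<close> and so is a word of length three; two such triples share exactly one good.\<close>
lemma ten_goods:
  assumes "card G = 10" "T \<subseteq> A" "card T = 6" "\<And>i c. i \<in> T \<Longrightarrow> c \<in> I i \<Longrightarrow> 3 \<le> card (B i c)"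
  shows False
proof -
  have finT: "finite T" using assms(3) by (metis card.infinite zero_neq_numeral)
  \<comment> \<open>The sizes are 3, 3 and 4, so at least one triple differs from
    \<open>com i\<close>.\<close>
  have ex: "\<exists>c\<in>I i. c \<noteq> com i \<and> card (B i c) = 3" if iT: "i \<in> T" for i
  proof -
    have iA: "i \<in> A" using iT assms(2) by blast
    obtain c d where cd: "c \<noteq> d" "I i = {com i, c, d}" "c \<noteq> com i" "d \<noteq> com i" using two_others[OF iA] .
    have "card (B i (com i)) + card (B i c) + card (B i d) = 10"
      using share_sum[OF iA] cd assms(1) by simp
    then show ?thesis
      using assms(4)[OF iT, of c] assms(4)[OF iT, of d] assms(4)[OF iT, of "com i"] cd by fastforce
  qed
  then obtain c where c: "\<And>i. i \<in> T \<Longrightarrow> c i \<in> I i" "\<And>i. i \<in> T \<Longrightarrow> c i \<noteq> com i"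
    "\<And>i. i \<in> T \<Longrightarrow> card (B i (c i)) = 3" by metis
  define X where "X i = B i (c i)" for i
  have finX: "finite (X i)" for i unfolding X_def using finG by (rule finite_share)
  have trans: "f j ` X i = I j" "inj_on (f j) (X i)" if "i \<in> T" "j \<in> T" "i \<noteq> j" for i j
  proof -
    show 1: "f j ` X i = I j" unfolding X_def
      using noncom_surj[of i j "c i"] that c assms(2) by blast
    show "inj_on (f j) (X i)"
      by (rule eq_card_imp_inj_on) (use finX 1 c(3) three that assms(2) in \<open>auto simp: X_def\<close>)
  qed
  obtain j where j: "j \<in> T" using assms(3) by fastforce
  have jA: "j \<in> A" using j assms(2) by blast
  obtain p q where pq: "I j = {c j, p, q}" "p \<noteq> c j" "q \<noteq> c j" "p \<noteq> q"
  proof -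
    have "card (I j - {c j}) = 2" using three[OF jA] c(1)[OF j] by simp
    then obtain p q where "I j - {c j} = {p, q}" "p \<noteq> q" by (meson card_2_iff)
    then show ?thesis using that[of p q] c(1)[OF j] by blast
  qed
  \<comment> \<open>The letter of word \<open>i\<close> at position \<open>k\<close>: the only good
    of \<open>X i\<close> in bundle \<open>k\<close> of agent \<open>j\<close>.\<close>
  define g where "g k i = (THE x. x \<in> X i \<and> f j x = k)" for k i
  let ?W = "T - {j}"
  have g: "g k i \<in> X i" "f j (g k i) = k" if "i \<in> ?W" "k \<in> I j" for k i
  proof -
    have "f j ` X i = I j" "inj_on (f j) (X i)" using trans[of i j] that(1) j by auto
    then have "\<exists>!x. x \<in> X i \<and> f j x = k"
      using that(2) by (metis (no_types, lifting) image_iff inj_on_eq_iff)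
    then have "g k i \<in> X i \<and> f j (g k i) = k" unfolding g_def by (rule theI')
    then show "g k i \<in> X i" "f j (g k i) = k" by auto
  qed
  have XG: "X i \<subseteq> G" for i unfolding X_def by (rule share_subset)
  have X: "X i = {g (c j) i, g p i, g q i}" if i: "i \<in> ?W" for i
  proof
    show "{g (c j) i, g p i, g q i} \<subseteq> X i" using g(1)[OF i] pq by simp
    show "X i \<subseteq> {g (c j) i, g p i, g q i}"
    proof
      fix x assume x: "x \<in> X i"
      have inj: "inj_on (f j) (X i)" using trans(2) i j by auto
      have "f j x \<in> I j" using partD(3)[OF parts[OF jA]] x XG by blast
      then have "x = g (f j x) i" using inj_onD[OF inj _ x g(1)[OF i]] g(2)[OF i] by simp
      then show "x \<in> {g (c j) i, g p i, g q i}" using \<open>f j x \<in> I j\<close> pq by auto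
    qed
  qed
  have sub: "g k ` ?W \<subseteq> B j k" if "k \<in> I j" for k
    using g[OF _ that] XG unfolding share_def by blast
  have le: "card (g k ` ?W) \<le> card (B j k)" if "k \<in> I j" for k
    using sub[OF that] finG by (intro card_mono finite_share)
  \<comment> \<open>Alphabet sizes: bundle \<open>c j\<close> is a triple, and bundle
    \<open>p\<close> has at most 10 - 3 - 3 goods.\<close>
  have b3: "card (g (c j) ` ?W) \<le> 3" using le[of "c j"] c(1,3)[OF j] by simp
  have b4: "card (g p ` ?W) \<le> 4"
  proof -
    have "card (B j (c j)) + card (B j p) + card (B j q) = 10"
      using share_sum[OF jA] pq assms(1) by simp
    then show ?thesis using le[of p] assms(4)[OF j, of "c j"] assms(4)[OF j, of q] pq by simp
  qed
  have c5: "card ?W = 5" using assms(3) j finT by simp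
  have ag: "(g (c j) u = g (c j) w \<and> g p u \<noteq> g p w \<and> g q u \<noteq> g q w) \<or>
      (g (c j) u \<noteq> g (c j) w \<and> g p u = g p w \<and> g q u \<noteq> g q w) \<or>
      (g (c j) u \<noteq> g (c j) w \<and> g p u \<noteq> g p w \<and> g q u = g q w)"
    if u: "u \<in> ?W" and w: "w \<in> ?W" and "u \<noteq> w" for u w
  proof -
    have ne: "g k i \<noteq> g l m" if "i \<in> ?W" "m \<in> ?W" "k \<in> I j" "l \<in> I j" "k \<noteq> l" for i m k l
      using g(2)[of i k] g(2)[of m l] that by metis
    \<comment> \<open>\<open>f w\<close> maps \<open>X u\<close> bijectively onto the bundles of
      \<open>w\<close>, one of which is \<open>X w\<close>; so \<open>X u\<close> and
      \<open>X w\<close> have exactly one common good.\<close>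
    have "c w \<in> f w ` X u" using trans(1)[of u w] u w \<open>u \<noteq> w\<close> c(1)[of w] by auto
    then obtain x where x: "x \<in> X u" "f w x = c w" by auto
    then have "x \<in> X w" using XG unfolding X_def share_def by blast
    have uniq: "y = x" if "y \<in> X u" "y \<in> X w" for y
    proof -
      have "f w y = c w" using that(2) by (simp add: X_def share_def)
      then show ?thesis using trans(2)[of u w] u w \<open>u \<noteq> w\<close> x that(1) unfolding inj_on_def by auto
    qed
    have K: "c j \<in> I j" "p \<in> I j" "q \<in> I j" using pq by auto
    have eqs: "g k u = g l w \<Longrightarrow> k = l" if "k \<in> I j" "l \<in> I j" for k l
      using ne[of u w k l] u w that by blast
    have two: False if "g k u = g k w" "g l u = g l w" "k \<in> I j" "l \<in> I j" "k \<noteq> l" for k l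
      using uniq[of "g k u"] uniq[of "g l u"] g(1)[of u] g(1)[of w] ne[of u u k l] that u w by metis
    have "g (c j) u = g (c j) w \<or> g p u = g p w \<or> g q u = g q w"
    proof -
      have "x \<in> {g (c j) u, g p u, g q u}" "x \<in> {g (c j) w, g p w, g q w}"
        using x(1) \<open>x \<in> X w\<close> X[OF u] X[OF w] by auto
      then show ?thesis using eqs K by (metis insert_iff singletonD)
    qed
    then show ?thesis using two K pq by metis
  qed
  show False by (rule code_words_bound[OF c5 b3 b4 ag])
qed

lemma pair_agents:
  assumes "S \<subseteq> A" "\<And>i. i \<in> S \<Longrightarrow> \<exists>c\<in>I i. card (B i c) = 2"
  shows "card S \<le> 1"
proof (rule ccontr)
  assume "\<not> ?thesis"
  then obtain i j where "i \<in> S" "j \<in> S" "i \<noteq> j"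
    by (metis One_nat_def card_le_Suc0_iff_eq card.infinite le_SucI le_zero_eq linorder_le_cases)
  then show False using one_pair_agent[of i j] assms by blast
qed

lemma triple_agents:
  assumes "\<not> (\<exists>c\<in>I i. card (B i c) = 2)" "i \<in> A" "c \<in> I i"
  shows "3 \<le> card (B i c)"
  using assms share_ge2[OF assms(2,3)] by fastforce

lemma card_split:
  "card A \<le> 1 + card {i\<in>A. \<not> (\<exists>c\<in>I i. card (B i c) = 2)}"
proof -
  let ?P = "{i\<in>A. \<exists>c\<in>I i. card (B i c) = 2}" and ?T = "{i\<in>A. \<not> (\<exists>c\<in>I i. card (B i c) = 2)}"
  have "card ?P \<le> 1" by (rule pair_agents) auto
  moreover have "card A = card (?P \<union> ?T)" by (rule arg_cong[of _ _ card]) auto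
  moreover have "card (?P \<union> ?T) \<le> card ?P + card ?T" by (rule card_Un_le)
  ultimately show ?thesis by linarith
qed

text \<open>At most one of four agents has a pair; the bundles of three others have at least, hence
  exactly, three goods.\<close>

lemma nine_goods: "card G = 9 \<Longrightarrow> card A \<le> 3"
proof (rule ccontr)
  assume G: "card G = 9" and "\<not> card A \<le> 3"
  then have "3 \<le> card {i\<in>A. \<not> (\<exists>c\<in>I i. card (B i c) = 2)}" using card_split by linarith
  then obtain T where T: "T \<subseteq> {i\<in>A. \<not> (\<exists>c\<in>I i. card (B i c) = 2)}" "card T = 3"
    by (meson obtain_subset_with_card_n)
  have "card (B i c) = 3" if "i \<in> T" "c \<in> I i" for i c
  proof -
    have i: "i \<in> A" using T that by blast
    have ge: "3 \<le> card (B i c)" if "c \<in> I i" for c using triple_agents[OF _ i that] T \<open>i \<in> T\<close> by blast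
    have fI: "finite (I i)" using partD(1)[OF parts[OF i]] .
    have "(\<Sum>d\<in>I i - {c}. 3) \<le> (\<Sum>d\<in>I i - {c}. card (B i d))" using ge by (intro sum_mono) auto
    moreover have "card (I i - {c}) = 2" using three[OF i] that by simp
    moreover have "(\<Sum>d\<in>I i. card (B i d)) = card (B i c) + (\<Sum>d\<in>I i - {c}. card (B i d))"
      using fI that by (simp add: sum.remove)
    ultimately have "card (B i c) \<le> 3" using share_sum[OF i] G by simp
    then show ?thesis using ge[OF that(2)] by simp
  qed
  then show False using nine_triples[OF G, of T] T by blast
qed

lemma ten_goods_card: "card G = 10 \<Longrightarrow> card A \<le> 6"
proof (rule ccontr)
  assume G: "card G = 10" and "\<not> card A \<le> 6"
  then have "6 \<le> card {i\<in>A. \<not> (\<exists>c\<in>I i. card (B i c) = 2)}" using card_split by linarith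
  then obtain T where T: "T \<subseteq> {i\<in>A. \<not> (\<exists>c\<in>I i. card (B i c) = 2)}" "card T = 6"
    by (meson obtain_subset_with_card_n)
  then show False using ten_goods[OF G, of T] triple_agents by blast
qed

lemma eight_goods: "card G \<le> 8 \<Longrightarrow> False"
proof -
  assume G: "card G \<le> 8"
  have E: "{i\<in>A. \<not> (\<exists>c\<in>I i. card (B i c) = 2)} = {}"
  proof (rule ccontr)
    assume "\<not> ?thesis"
    then obtain i where i: "i \<in> A" "\<not> (\<exists>c\<in>I i. card (B i c) = 2)" by blast
    have "(\<Sum>d\<in>I i. 3) \<le> (\<Sum>d\<in>I i. card (B i d))" using triple_agents i by (intro sum_mono) auto
    then show False using share_sum[OF i(1)] three[OF i(1)] G by simp
  qed
  then show False using card_split agents(2) unfolding E by simp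
qed

end

subsection \<open>Removing pairs\<close>

lemma incidence_sum:
  assumes "finite Q" "finite H" "\<And>i. i \<in> Q \<Longrightarrow> T i \<subseteq> H"
  shows "(\<Sum>i\<in>Q. card (T i)) = (\<Sum>a\<in>H. card {i\<in>Q. a \<in> T i})"
proof -
  have "card (T i) = (\<Sum>a\<in>H. if a \<in> T i then 1 else 0)" if "i \<in> Q" for i
    using assms(2) assms(3)[OF that] by (simp add: sum.If_cases Int_absorb1 Int_absorb2 inf_commute)
  then have "(\<Sum>i\<in>Q. card (T i)) = (\<Sum>i\<in>Q. \<Sum>a\<in>H. if a \<in> T i then 1 else 0)" by simp
  also have "\<dots> = (\<Sum>a\<in>H. \<Sum>i\<in>Q. if a \<in> T i then 1 else 0)" by (rule sum.swap)
  also have "\<dots> = (\<Sum>a\<in>H. card {i\<in>Q. a \<in> T i})"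
    using assms(1) by (simp add: sum.If_cases Collect_conj_eq)
  finally show ?thesis .
qed

lemma popular:
  assumes "finite Q" "finite H" "\<And>i. i \<in> Q \<Longrightarrow> T i \<subseteq> H" "\<And>i. i \<in> Q \<Longrightarrow> p \<le> card (T i)"
    "card H * s < card Q * p"
  shows "\<exists>a\<in>H. s < card {i\<in>Q. a \<in> T i}"
proof (rule ccontr)
  assume "\<not> ?thesis"
  then have "(\<Sum>a\<in>H. card {i\<in>Q. a \<in> T i}) \<le> (\<Sum>a\<in>H. s)" by (intro sum_mono) (auto simp: not_less)
  moreover have "(\<Sum>i\<in>Q. p) \<le> (\<Sum>i\<in>Q. card (T i))" using assms(4) by (intro sum_mono)
  ultimately show False using incidence_sum[OF assms(1-3)] assms(5) by simp
qed

context ordered_goods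
begin

text \<open>Fixes one partition per agent, with a prescribed property \<open>Q\<close>, in order to
  enter the locale.\<close>

lemma unsat3_choose:
  assumes "finite A" "3 \<le> card A" "G \<noteq> {}" "\<And>L. L \<subseteq> A \<Longrightarrow> card L = 3 \<Longrightarrow> \<not> sat L G"
    and "\<And>i. i \<in> A \<Longrightarrow> \<exists>I f. card I = 3 \<and> part i I G f \<and> Q i I f"
  shows "\<exists>I f. unsat3 v mu A G I f \<and> (\<forall>i\<in>A. Q i (I i) (f i))"
proof -
  have "\<forall>i\<in>A. \<exists>p. card (fst p) = 3 \<and> part i (fst p) G (snd p) \<and> Q i (fst p) (snd p)"
    using assms(5) by (metis fst_conv snd_conv)
  then obtain p where p: "\<forall>i\<in>A. card (fst (p i)) = 3 \<and> part i (fst (p i)) G (snd (p i)) \<and> Q i (fst (p i)) (snd (p i))"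
    by (rule bchoice[THEN exE])
  have "unsat3 v mu A G (fst \<circ> p) (snd \<circ> p)"
    by unfold_locales (use assms p in auto)
  then show ?thesis using p by (intro exI[of _ "fst \<circ> p"] exI[of _ "snd \<circ> p"]) auto
qed

lemma sat_trivial: "(\<And>i. i \<in> L \<Longrightarrow> mu i \<le> 0) \<Longrightarrow> sat L G"
  unfolding sat_def disjoint_family_on_def by (intro exI[of _ "\<lambda>_. {}"]) (auto simp: val_def)

lemma feas_empty:
  assumes "feas i n {}" "0 < n"
  shows "mu i \<le> 0"
  using assms unfolding feas_def part_def
  by (metis card.empty empty_iff ex_in_conv less_irrefl finite.emptyI share_subset subset_empty val_def sum.empty)

text \<open>Spare candidates make up for additional goods: an unsatisfiable family has at most six
  agents on ten goods, at most three on nine, and cannot exist on eight or fewer.\<close>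

lemma three_sat:
  assumes "finite A" "\<And>i. i \<in> A \<Longrightarrow> feas i 3 G"
    and "(card G \<le> 8 \<and> 3 \<le> card A) \<or> (card G = 9 \<and> 4 \<le> card A) \<or> (card G = 10 \<and> 7 \<le> card A)"
  shows "\<exists>L\<subseteq>A. card L = 3 \<and> sat L G"
proof (rule ccontr)
  assume no: "\<not> ?thesis"
  have A3: "3 \<le> card A" using assms(3) by auto
  have "G \<noteq> {}"
  proof
    assume "G = {}"
    obtain L where L: "L \<subseteq> A" "card L = 3" using obtain_subset_with_card_n[OF A3] by blast
    have "mu i \<le> 0" if "i \<in> L" for i using feas_empty[of i 3] assms(2) L that \<open>G = {}\<close> by auto
    then show False using no L sat_trivial by blast
  qed
  moreover have "\<exists>I f. card I = 3 \<and> part i I G f \<and> True" if "i \<in> A" for i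
    using assms(2)[OF that] by (auto simp: feas_def)
  ultimately have "\<exists>I f. unsat3 v mu A G I f \<and> (\<forall>i\<in>A. True)"
    by (intro unsat3_choose[OF assms(1) A3]) (use no in auto)
  then obtain I f where "unsat3 v mu A G I f" by (elim exE conjE)
  then interpret unsat3 v mu A G I f .
  show False using assms(3) eight_goods nine_goods ten_goods_card by fastforce
qed

definition rich :: "nat \<Rightarrow> nat \<Rightarrow> nat set \<Rightarrow> nat \<Rightarrow> bool" where
  "rich i n G p \<longleftrightarrow> (\<exists>I f. card I = n \<and> part i I G f \<and> p \<le> card {k\<in>I. card (share f G k) = 2})"

text \<open>The number of pairs is recorded for the same partition that has a pair with better good
  \<open>a\<close>, so that \<open>p - 1\<close> pairs survive the loss of this pair.\<close>

definition ptop :: "nat \<Rightarrow> nat \<Rightarrow> nat set \<Rightarrow> nat \<Rightarrow> nat \<Rightarrow> bool" where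
  "ptop i n G a p \<longleftrightarrow> (\<exists>I f k b. card I = n \<and> part i I G f \<and> p \<le> card {k\<in>I. card (share f G k) = 2} \<and>
     k \<in> I \<and> share f G k = {a, b} \<and> a < b)"

lemma rich_feas: "rich i n G p \<Longrightarrow> feas i n G"
  unfolding rich_def feas_def by blast

lemma ptop_mono: "ptop i n G a p \<Longrightarrow> q \<le> p \<Longrightarrow> ptop i n G a q"
proof -
  assume "ptop i n G a p" and le: "q \<le> p"
  then obtain I f k b where I: "card I = n" "part i I G f" "p \<le> card {k\<in>I. card (share f G k) = 2}"
    "k \<in> I" "share f G k = {a, b}" "a < b" unfolding ptop_def by blast
  moreover have "q \<le> card {k\<in>I. card (share f G k) = 2}" using le I(3) by (rule order_trans)
  ultimately show ?thesis unfolding ptop_def by blast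
qed

lemma two_pairs_sat:
  assumes "card L = 3" "\<And>i. i \<in> L \<Longrightarrow> feas i 3 G" "i \<in> L" "j \<in> L" "i \<noteq> j" "rich i 3 G 1" "rich j 3 G 1"
  shows "sat L G"
proof (rule ccontr)
  assume no: "\<not> ?thesis"
  have finL: "finite L" using assms(1) by (metis card.infinite zero_neq_numeral)
  define Q where "Q l J (h :: nat \<Rightarrow> nat) \<longleftrightarrow> (l \<in> {i, j} \<longrightarrow> (\<exists>k\<in>J. card (share h G k) = 2))" for l J h
  have "L' = L" if "L' \<subseteq> L" "card L' = 3" for L'
    using card_subset_eq[OF finL that(1)] that(2) assms(1) by simp
  then have un: "\<not> sat L' G" if "L' \<subseteq> L" "card L' = 3" for L' using no that by blast
  have pair: "\<exists>I f. card I = 3 \<and> part l I G f \<and> (\<exists>k\<in>I. card (share f G k) = 2)" if "rich l 3 G 1" for l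
  proof -
    obtain I f where If: "card I = 3" "part l I G f" "1 \<le> card {k\<in>I. card (share f G k) = 2}"
      using \<open>rich l 3 G 1\<close> unfolding rich_def by blast
    then have "{k\<in>I. card (share f G k) = 2} \<noteq> {}" by (metis card.empty not_one_le_zero)
    then show ?thesis using If by blast
  qed
  have "G \<noteq> {}"
  proof
    assume "G = {}"
    with pair[OF assms(6)] show False by (auto simp: share_def)
  qed
  moreover have "\<exists>I f. card I = 3 \<and> part l I G f \<and> Q l I f" if "l \<in> L" for l
  proof (cases "l \<in> {i, j}")
    case True
    then have "rich l 3 G 1" using assms(6,7) by auto
    from pair[OF this] show ?thesis unfolding Q_def by blast
  next
    case False
    then show ?thesis using assms(2)[OF that] unfolding Q_def feas_def by blast
  qed
  ultimately have "\<exists>I f. unsat3 v mu L G I f \<and> (\<forall>l\<in>L. Q l (I l) (f l))"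
    by (intro unsat3_choose[OF finL]) (use un assms(1) in auto)
  then obtain I f where u: "unsat3 v mu L G I f" and Q: "\<forall>l\<in>L. Q l (I l) (f l)"
    by (elim exE conjE)
  interpret unsat3 v mu L G I f by (rule u)
  show False using bspec[OF Q assms(3)] bspec[OF Q assms(4)] one_pair_agent[OF assms(3,4,5)] unfolding Q_def by blast
qed

lemma three_triples_sat:
  assumes "card L = 3" "card G = 9"
    and "\<And>i. i \<in> L \<Longrightarrow> \<exists>I f. card I = 3 \<and> part i I G f \<and> (\<forall>k\<in>I. card (share f G k) = 3)"
  shows "sat L G"
proof (rule ccontr)
  assume no: "\<not> ?thesis"
  have finL: "finite L" using assms(1) by (metis card.infinite zero_neq_numeral)
  have "L' = L" if "L' \<subseteq> L" "card L' = 3" for L'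
    using card_subset_eq[OF finL that(1)] that(2) assms(1) by simp
  then have un: "\<not> sat L' G" if "L' \<subseteq> L" "card L' = 3" for L' using no that by blast
  have "G \<noteq> {}" using assms(2) by auto
  then have "\<exists>I f. unsat3 v mu L G I f \<and> (\<forall>l\<in>L. \<forall>k\<in>I l. card (share (f l) G k) = 3)"
    by (intro unsat3_choose[OF finL]) (use un assms(1,3) in auto)
  then obtain I f where u: "unsat3 v mu L G I f"
    and Q: "\<forall>l\<in>L. \<forall>k\<in>I l. card (share (f l) G k) = 3"
    by (elim exE conjE)
  interpret unsat3 v mu L G I f by (rule u)
  show False using nine_triples[OF assms(2) subset_refl assms(1)] Q by blast
qed

text \<open>\<open>Max\<close> yields the least valuable accepted partner of \<open>a\<close>, hence
  every accepted partner is at least as good as \<open>b\<close>.\<close>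

lemma best_pair:
  assumes "finite A" "finite G" "j \<in> A" "c \<in> G" "a < c" "mu j \<le> val j {a, c}"
  obtains b l where "b \<in> G" "a < b" "l \<in> A" "mu l \<le> val l {a, b}"
    "\<And>i d. i \<in> A \<Longrightarrow> d \<in> G \<Longrightarrow> a < d \<Longrightarrow> mu i \<le> val i {a, d} \<Longrightarrow> d \<le> b"
proof -
  let ?S = "{d\<in>G. a < d \<and> (\<exists>i\<in>A. mu i \<le> val i {a, d})}"
  have fin: "finite ?S" using assms(2) by simp
  have "?S \<noteq> {}" using assms(3-6) by auto
  then have M: "Max ?S \<in> ?S" by (rule Max_in[OF fin])
  then obtain l where l: "l \<in> A" "mu l \<le> val l {a, Max ?S}" by auto
  show ?thesis
  proof (rule that[of "Max ?S" l])
    fix i d assume "i \<in> A" "d \<in> G" "a < d" "mu i \<le> val i {a, d}"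
    then have "d \<in> ?S" by auto
    then show "d \<le> Max ?S" using fin by simp
  qed (use M l in auto)
qed

text \<open>The bundle \<open>{a, c}\<close> dominates \<open>{a, b}\<close> and is the only one
  lost. The collecting bundle does not grow: two goods leave and a bundle of two disappears.\<close>

lemma keep_top:
  assumes "part j I G f" "k \<in> I" "share f G k = {a, c}" "a < c" "c \<le> b" "b \<in> G" "card I = Suc n" "0 < n"
  obtains f' where "part j (I - {k}) (G - {a, b}) f'"
    "\<And>l. l \<in> I - {k} \<Longrightarrow> card (share f' (G - {a, b}) l) = card (share f G l)"
proof -
  have fin: "finite I" "finite G" using partD[OF assms(1)] by auto
  have aG: "a \<in> G" using assms(3) share_subset by blast
  have "card (I - {k}) = n" using assms(2,7) fin by simp
  then obtain k0 where k0: "k0 \<in> I" "k0 \<noteq> k" using assms(8) by (metis DiffE card.empty ex_in_conv less_irrefl singletonI)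
  have dom: "dominates (share f G k) {a, b}"
    unfolding assms(3) using assms(4,5) by (intro dominates_pair[of a _ c]) auto
  obtain f' where f': "part j (I - {k}) (G - {a, b}) f'"
    "\<And>l. l \<in> I \<Longrightarrow> l \<noteq> k \<Longrightarrow> l \<noteq> k0 \<Longrightarrow> card (share f' (G - {a, b}) l) = card (share f G l)"
    "card (share f G k0) \<le> card (share f' (G - {a, b}) k0)"
    using part_spare[OF assms(1,2) dom _ k0] aG assms(6) by blast
  have I: "I = insert k (insert k0 (I - {k, k0}))" using k0 assms(2) by blast
  have rest: "(\<Sum>l\<in>I - {k, k0}. card (share f' (G - {a, b}) l)) = (\<Sum>l\<in>I - {k, k0}. card (share f G l))"
    using f'(2) by (intro sum.cong) auto
  have "card G = card (share f G k) + (card (share f G k0) + (\<Sum>l\<in>I - {k, k0}. card (share f G l)))"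
    unfolding part_card[OF assms(1), symmetric] by (subst I) (use fin k0 in simp)
  moreover have "card (share f G k) = 2" using assms(3,4) by simp
  moreover have "card (G - {a, b}) = card G - 2" using aG assms(4-6) fin by (simp add: card_Diff_subset)
  moreover have "card (G - {a, b}) = card (share f' (G - {a, b}) k0) + (\<Sum>l\<in>I - {k, k0}. card (share f' (G - {a, b}) l))"
  proof -
    have "I - {k} = insert k0 (I - {k, k0})" using k0 by blast
    then show ?thesis unfolding part_card[OF f'(1), symmetric] using fin by simp
  qed
  ultimately have "card (share f' (G - {a, b}) k0) = card (share f G k0)" using rest f'(3) by simp
  then show ?thesis using that[OF f'(1)] f'(2) by blast
qed

lemma keep_top_rich:
  assumes "ptop j (Suc n) G a p" "0 < n" "b \<in> G"
    and "\<And>c. c \<in> G \<Longrightarrow> a < c \<Longrightarrow> mu j \<le> val j {a, c} \<Longrightarrow> c \<le> b"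
  shows "rich j n (G - {a, b}) (p - 1)"
proof -
  obtain I f k c where I: "card I = Suc n" "part j I G f" "p \<le> card {k\<in>I. card (share f G k) = 2}"
    "k \<in> I" "share f G k = {a, c}" "a < c" using assms(1) unfolding ptop_def by blast
  have "c \<in> G" using I(5) share_subset by blast
  moreover have "mu j \<le> val j {a, c}" using partD(4)[OF I(2,4)] I(5) by simp
  ultimately have "c \<le> b" using assms(4) I(6) by blast
  then obtain f' where f': "part j (I - {k}) (G - {a, b}) f'"
    "\<And>l. l \<in> I - {k} \<Longrightarrow> card (share f' (G - {a, b}) l) = card (share f G l)"
    using keep_top[OF I(2,4,5,6) _ assms(3) I(1) assms(2)] by blast
  have fin: "finite I" using partD(1)[OF I(2)] .
  have "{l\<in>I - {k}. card (share f' (G - {a, b}) l) = 2} = {l\<in>I. card (share f G l) = 2} - {k}"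
    using f'(2) by auto
  moreover have "p - 1 \<le> card ({l\<in>I. card (share f G l) = 2} - {k})"
    using I(3) diff_card_le_card_Diff[of "{k}" "{l\<in>I. card (share f G l) = 2}"] by simp
  moreover have "card (I - {k}) = n" using I(1,4) fin by simp
  ultimately have "card (I - {k}) = n \<and> part j (I - {k}) (G - {a, b}) f' \<and>
      p - 1 \<le> card {l\<in>I - {k}. card (share f' (G - {a, b}) l) = 2}"
    using f'(1) by simp
  then show ?thesis unfolding rich_def by blast
qed

text \<open>The good \<open>a\<close> leaves together with its worst partner \<open>b\<close> that some agent accepts, so the
  agents of \<open>K\<close> lose just the pair topped by \<open>a\<close>. The one further agent either takes \<open>{a, b}\<close> herself
  or values it at most at her share and can merge bundles.\<close>
lemma reduce_top:
  assumes "finite L" "K \<subseteq> L" "K \<noteq> {}" "card (L - K) \<le> 1" "\<And>j. j \<in> L \<Longrightarrow> feas j (Suc n) G"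
    "\<And>j. j \<in> K \<Longrightarrow> ptop j (Suc n) G a p" "0 < n"
    and step: "\<And>i G'. i \<in> L \<Longrightarrow> finite G' \<Longrightarrow> G' \<subseteq> G - {a} \<Longrightarrow> card G' = card G - 2 \<Longrightarrow>
      (\<And>j. j \<in> L - {i} \<Longrightarrow> feas j n G') \<Longrightarrow> (\<And>j. j \<in> K - {i} \<Longrightarrow> rich j n G' (p - 1)) \<Longrightarrow> sat (L - {i}) G'"
  shows "sat L G"
proof -
  obtain j0 where j0: "j0 \<in> K" using assms(3) by blast
  then obtain I f k c where I: "card I = Suc n" "part j0 I G f" "k \<in> I" "share f G k = {a, c}" "a < c"
    using assms(6) unfolding ptop_def by blast
  have G: "a \<in> G" "c \<in> G" using I(4) share_subset by blast+
  have acc: "mu j0 \<le> val j0 {a, c}" using partD(4)[OF I(2,3)] I(4) by simp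
  have "j0 \<in> L" using j0 assms(2) by blast
  then obtain b l where b: "b \<in> G" "a < b" "l \<in> L" "mu l \<le> val l {a, b}"
    "\<And>i d. i \<in> L \<Longrightarrow> d \<in> G \<Longrightarrow> a < d \<Longrightarrow> mu i \<le> val i {a, d} \<Longrightarrow> d \<le> b"
    using best_pair[OF assms(1) partD(2)[OF I(2)] _ G(2) I(5) acc] by blast
  have rich: "rich j n (G - {a, b}) (p - 1)" if "j \<in> K" for j
    using keep_top_rich[OF assms(6)[OF that] assms(7) b(1)] b(5) assms(2) that by blast
  have fG: "finite G" using partD(2)[OF I(2)] .
  have fin: "sat L G" if i: "i \<in> L" "mu i \<le> val i {a, b}" "\<And>j. j \<in> L - {i} \<Longrightarrow> feas j n (G - {a, b})" for i
  proof -
    have "sat (L - {i}) (G - {a, b})"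
      using fG G(1) b(1,2) by (intro step i rich) (auto simp: card_Diff_subset)
    then have "sat (insert i (L - {i})) G" by (rule sat_insert) (use G b i in auto)
    then show ?thesis using i(1) by (simp add: insert_absorb)
  qed
  show ?thesis
  proof (cases "\<exists>i\<in>L - K. mu i < val i {a, b}")
    case True
    then obtain i where i: "i \<in> L - K" "mu i < val i {a, b}" by blast
    have "L - K = {i}" using i(1) assms(1,4) card_le_Suc0_iff_eq[of "L - K"] by auto
    then have "j \<in> K" if "j \<in> L - {i}" for j using that by blast
    then have "feas j n (G - {a, b})" if "j \<in> L - {i}" for j using rich_feas[OF rich] that by blast
    then show ?thesis using fin[of i] i by simp
  next
    case False
    have "feas j n (G - {a, b})" if "j \<in> L" for j
    proof (cases "j \<in> K")
      case True then show ?thesis using rich rich_feas by blast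
    next
      case jK: False
      then have "val j {a, b} \<le> mu j" using False that by (meson DiffI not_less)
      then show ?thesis using feas_merge_pair[OF assms(5)[OF that] assms(7) G(1) b(1)] by blast
    qed
    then show ?thesis using fin[of l] b(3,4) by auto
  qed
qed

text \<open>Without an acceptable single good every bundle has at least two goods. Then its size,
  plus one if it is a pair, is at least three; summing over the bundles bounds the number of
  pairs.\<close>

lemma reject_rich:
  assumes "feas i n G" "G \<noteq> {}" "\<And>g. g \<in> G \<Longrightarrow> v i g < mu i"
  shows "rich i n G (3 * n - card G)" "2 * n \<le> card G"
    "\<And>I f k. part i I G f \<Longrightarrow> k \<in> I \<Longrightarrow> 2 \<le> card (share f G k)"
proof -
  obtain g where g: "g \<in> G" using assms(2) by blast
  have pos: "0 < mu i" using assms(3)[OF g] nonneg[of i g] by linarith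
  show ge2: "2 \<le> card (share f G k)" if If: "part i I G f" "k \<in> I" for I f k
  proof (rule ccontr)
    assume "\<not> ?thesis"
    then have "card (share f G k) = 0 \<or> card (share f G k) = 1" by linarith
    then have "val i (share f G k) < mu i"
    proof
      assume "card (share f G k) = 0"
      then have "share f G k = {}" using partD(5)[OF If(1)] by simp
      then show ?thesis using pos by (simp add: val_def)
    next
      assume "card (share f G k) = 1"
      then obtain x where "share f G k = {x}" by (rule card_1_singletonE)
      then show ?thesis using assms(3)[of x] share_subset by (simp add: val_def) (metis insertI1 share_subset subsetD)
    qed
    then show False using partD(4)[OF If] by simp
  qed
  obtain I f where I: "card I = n" "part i I G f" using assms(1) unfolding feas_def by blast
  let ?P = "{k\<in>I. card (share f G k) = 2}"
  have fin: "finite I" using partD(1)[OF I(2)] .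
  have "(\<Sum>k\<in>I. 3) \<le> (\<Sum>k\<in>I. card (share f G k) + (if card (share f G k) = 2 then 1 else 0))"
    using ge2[OF I(2)] by (intro sum_mono) fastforce
  also have "\<dots> = card G + card ?P"
    using fin by (simp add: sum.distrib part_card[OF I(2)] sum.If_cases Collect_conj_eq)
  finally have "3 * n - card G \<le> card ?P" using I(1) by simp
  then show "rich i n G (3 * n - card G)" using I unfolding rich_def by blast
  have "(\<Sum>k\<in>I. 2) \<le> (\<Sum>k\<in>I. card (share f G k))" using ge2[OF I(2)] by (intro sum_mono)
  then show "2 * n \<le> card G" using I(1) by (simp add: part_card[OF I(2)])
qed

text \<open>\<open>H\<close> contains all possible better goods of accepted pairs. Disjoint pairs
  have different better goods, so \<open>T\<close> is as large as the set of pairs.\<close>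

lemma part_tops:
  assumes "part i I G f" "\<And>x y. x \<in> G \<Longrightarrow> y \<in> G \<Longrightarrow> x \<notin> H \<Longrightarrow> x < y \<Longrightarrow> val i {x, y} < mu i"
  shows "\<exists>T\<subseteq>H. card T = card {k\<in>I. card (share f G k) = 2} \<and> (\<forall>a\<in>T. \<exists>k\<in>I. \<exists>b. share f G k = {a, b} \<and> a < b)"
proof -
  let ?P = "{k\<in>I. card (share f G k) = 2}" and ?m = "\<lambda>k. Min (share f G k)"
  have pair: "\<exists>b. share f G k = {?m k, b} \<and> ?m k < b" if "k \<in> ?P" for k
  proof -
    have "card (share f G k) = 2" using that by simp
    then obtain x y where "share f G k = {x, y}" "x \<noteq> y" by (meson card_2_iff)
    then show ?thesis by (cases "x < y") (auto simp: min_def insert_commute)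
  qed
  have inP: "?m k \<in> share f G k" if "k \<in> ?P" for k using pair[OF that] by (metis insertI1)
  have "inj_on ?m ?P"
    using inP share_def by (intro inj_onI) (metis (mono_tags, lifting) mem_Collect_eq)
  then have "card (?m ` ?P) = card ?P" by (rule card_image)
  moreover have "?m ` ?P \<subseteq> H"
  proof
    fix a assume "a \<in> ?m ` ?P"
    then obtain k where k: "k \<in> ?P" "a = ?m k" by blast
    obtain b where b: "share f G k = {a, b}" "a < b" using pair[OF k(1)] k(2) by blast
    then have "a \<in> G" "b \<in> G" using share_subset by blast+
    moreover have "mu i \<le> val i {a, b}" using partD(4)[OF assms(1)] k(1) b(1) by fastforce
    ultimately show "a \<in> H" using assms(2) b(2) by fastforce
  qed
  moreover have "\<forall>a\<in>?m ` ?P. \<exists>k\<in>I. \<exists>b. share f G k = {a, b} \<and> a < b" using pair by blast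
  ultimately show ?thesis by (intro exI[of _ "?m ` ?P"]) auto
qed

lemma rich_tops:
  assumes "rich i n G p" "\<And>x y. x \<in> G \<Longrightarrow> y \<in> G \<Longrightarrow> x \<notin> H \<Longrightarrow> x < y \<Longrightarrow> val i {x, y} < mu i"
  shows "\<exists>T\<subseteq>H. p \<le> card T \<and> (\<forall>a\<in>T. ptop i n G a p)"
proof -
  obtain I f where I: "card I = n" "part i I G f" "p \<le> card {k\<in>I. card (share f G k) = 2}"
    using assms(1) unfolding rich_def by blast
  obtain T where T: "T \<subseteq> H" "card T = card {k\<in>I. card (share f G k) = 2}"
    "\<forall>a\<in>T. \<exists>k\<in>I. \<exists>b. share f G k = {a, b} \<and> a < b"
    using part_tops[OF I(2) assms(2)] by blast
  have "ptop i n G a p" if "a \<in> T" for a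
    using bspec[OF T(3) that] I unfolding ptop_def by blast
  then show ?thesis using T(1,2) I(3) by (intro exI[of _ T]) auto
qed

text \<open>At most one pair is lost with the bundle of \<open>g\<close>. The leftovers of that
  bundle need a collector other than the \<open>q\<close> pairs to be kept; \<open>q < n\<close>
  makes room for it.\<close>

lemma rich_drop:
  assumes "rich i (Suc n) G p" "g \<in> G" "0 < n" "q < p" "q < n"
  shows "rich i n (G - {g}) q"
proof -
  obtain I f where I: "card I = Suc n" "part i I G f" "p \<le> card {k\<in>I. card (share f G k) = 2}"
    using assms(1) unfolding rich_def by blast
  let ?P = "{k\<in>I. card (share f G k) = 2}"
  have fin: "finite I" using partD(1)[OF I(2)] .
  have fg: "f g \<in> I" using partD(3)[OF I(2) assms(2)] .
  have "q \<le> card (?P - {f g})"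
    using I(3) assms(4) diff_card_le_card_Diff[of "{f g}" ?P] by simp
  then obtain R where R: "R \<subseteq> ?P - {f g}" "card R = q" by (meson obtain_subset_with_card_n)
  have c: "card (I - {f g}) = n" using fg I(1) fin by simp
  have "finite R" by (rule finite_subset[OF R(1)]) (use fin in simp)
  then have "\<not> I - {f g} \<subseteq> R" using card_mono[of R "I - {f g}"] R(2) c assms(5) by auto
  then obtain k0 where k0: "k0 \<in> I" "k0 \<noteq> f g" "k0 \<notin> R" by blast
  obtain f' where f': "part i (I - {f g}) (G - {g}) f'"
    "\<And>k. k \<in> I \<Longrightarrow> k \<noteq> f g \<Longrightarrow> k \<noteq> k0 \<Longrightarrow> share f' (G - {g}) k = share f G k"
    using part_drop[OF I(2) assms(2) k0(1,2)] by blast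
  have "R \<subseteq> {k\<in>I - {f g}. card (share f' (G - {g}) k) = 2}"
  proof
    fix x assume x: "x \<in> R"
    then have "x \<in> I" "x \<noteq> f g" "card (share f G x) = 2" "x \<noteq> k0" using R(1) k0(3) by auto
    then show "x \<in> {k\<in>I - {f g}. card (share f' (G - {g}) k) = 2}" using f'(2) by simp
  qed
  then have "q \<le> card {k\<in>I - {f g}. card (share f' (G - {g}) k) = 2}"
    using card_mono[of "{k\<in>I - {f g}. card (share f' (G - {g}) k) = 2}" R] fin R(2) by auto
  then have "card (I - {f g}) = n \<and> part i (I - {f g}) (G - {g}) f' \<and>
      q \<le> card {k\<in>I - {f g}. card (share f' (G - {g}) k) = 2}"
    using f'(1) c by simp
  then show ?thesis unfolding rich_def by blast
qed

text \<open>Two of the best \<open>n + 2\<close> goods share one of the \<open>n + 1\<close>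
  bundles, which dominates the last two of these goods.\<close>

lemma feas_spare_two:
  assumes e: "strict_mono_on {..<card G} e" "e ` {..<card G} = G"
    and "Suc n < card G" "feas j (Suc n) G" "0 < n"
  shows "feas j n (G - {e n, e (Suc n)})"
proof -
  obtain I f where I: "card I = Suc n" "part j I G f" using assms(4) unfolding feas_def by blast
  have sub: "e ` {..<Suc (Suc n)} \<subseteq> G" using e(2) assms(3) by (metis Suc_leI image_mono lessThan_subset_iff)
  have "card (e ` {..<Suc (Suc n)}) = Suc (Suc n)"
    using strict_mono_on_imp_inj_on[OF e(1)] assms(3)
    by (subst card_image) (auto intro: inj_on_subset)
  then obtain y z where yz: "y \<in> e ` {..<Suc (Suc n)}" "z \<in> e ` {..<Suc (Suc n)}" "y < z" "f y = f z"
    using pigeonhole_pair[of I f "e ` {..<Suc (Suc n)}"] I sub unfolding part_def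
    by (metis image_mono lessI subset_trans)
  then obtain a b where ab: "a < Suc (Suc n)" "y = e a" "b < Suc (Suc n)" "z = e b" by auto
  have "a < b" using yz(3) ab assms(3) strict_mono_on_less[OF e(1)] by simp
  then have "y \<le> e n" "z \<le> e (Suc n)"
    using ab assms(3) strict_mono_on_leD[OF e(1)] by simp_all
  moreover have "e n \<noteq> e (Suc n)" using strict_mono_onD[OF e(1), of n "Suc n"] assms(3) by simp
  ultimately have "dominates (share f G (f y)) {e n, e (Suc n)}"
    using yz sub by (intro dominates_pair[of y _ z]) (auto simp: share_def)
  moreover have "f y \<in> I" using partD(3)[OF I(2)] yz(1) sub by blast
  moreover have "{e n, e (Suc n)} \<subseteq> G" using sub by auto
  ultimately show ?thesis using feas_spare[OF I(2) _ _ _ I(1) assms(5)] by blast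
qed

text \<open>Beyond three agents the best good is given away if anybody accepts it. Otherwise all
  bundles have two goods or more, which leaves only four or five agents; either the pair of
  \<open>feas_spare_two\<close> is accepted, or few goods can be the better good of a pair.\<close>

lemma sat_small:
  assumes "finite L" "card L = n" "finite G" "card G \<le> n + 5" "\<And>i. i \<in> L \<Longrightarrow> feas i n G"
  shows "sat L G"
  using assms
proof (induction n arbitrary: L G)
  case 0
  then show ?case by (intro sat_trivial) simp
next
  case (Suc n)
  show ?case
  proof (cases "G = {}")
    case True
    then show ?thesis using feas_empty[of _ "Suc n"] Suc.prems(5) by (intro sat_trivial) auto
  next
    case ne: False
    consider "n = 0" | "n = 1" | "n = 2" | "3 \<le> n" by linarith
    then show ?thesis
    proof cases
      case 1
      then obtain i where "L = {i}" using Suc.prems(2) by (metis One_nat_def card_1_singletonE)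
      then show ?thesis using feas_total[of i 1 G] Suc.prems(5) 1 by (auto intro: sat_single)
    next
      case 2
      then obtain i j where ij: "L = {i, j}" "i \<noteq> j"
        using Suc.prems(2) by (metis Suc_1 One_nat_def card_2_iff)
      then have "feas i 2 G" "feas j 2 G" using Suc.prems(5) 2 by (auto simp: numeral_2_eq_2)
      then show ?thesis using sat_cut_choose[of i G j] feas_total[of j 2 G] ij by simp
    next
      case 3
      then have "card L = 3" "card G \<le> 8" "\<And>i. i \<in> L \<Longrightarrow> feas i 3 G"
        using Suc.prems by (auto simp: numeral_3_eq_3 numeral_2_eq_2)
      then obtain L' where "L' \<subseteq> L" "card L' = 3" "sat L' G"
        using three_sat[of L G] Suc.prems(1) by auto
      then show ?thesis using card_subset_eq[OF Suc.prems(1)] \<open>card L = 3\<close> by metis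
    next
      case 4
      define m where "m = Min G"
      have m: "m \<in> G" "\<And>g. g \<in> G \<Longrightarrow> m \<le> g" using Suc.prems(3) ne by (auto simp: m_def)
      show ?thesis
      proof (cases "\<exists>i\<in>L. mu i \<le> v i m")
        case True
        then obtain i where i: "i \<in> L" "mu i \<le> v i m" by blast
        have "sat (L - {i}) (G - {m})"
          using Suc.prems i m(1) 4 by (intro Suc.IH) (auto intro!: feas_drop)
        then have "sat (insert i (L - {i})) G"
          by (rule sat_insert) (use m i in \<open>auto simp: val_def\<close>)
        then show ?thesis using i(1) by (simp add: insert_absorb)
      next
        case False
        then have rej: "v i g < mu i" if "i \<in> L" "g \<in> G" for i g
          using anti[OF m(2)[OF that(2)], of i] that(1) by force
        obtain l where l: "l \<in> L" using Suc.prems(2) by fastforce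
        have cG: "2 * Suc n \<le> card G" using reject_rich(2)[OF Suc.prems(5)[OF l] ne rej[OF l]] .
        then have n: "n = 3 \<or> n = 4" using Suc.prems(4) 4 by arith
        obtain e where e: "strict_mono_on {..<card G} e" "e ` {..<card G} = G"
          using finite_enum[OF Suc.prems(3)] .
        have lt: "Suc n < card G" using cG 4 by simp
        let ?X = "{e n, e (Suc n)}"
        have X: "?X \<subseteq> G" using e(2) lt by fastforce
        have less: "e u < e w \<longleftrightarrow> u < w" if "u < card G" "w < card G" for u w
          using that strict_mono_on_less[OF e(1)] by simp
        have c2: "card ?X = 2" using less[of n "Suc n"] lt by simp
        show ?thesis
        proof (cases "\<exists>i\<in>L. mu i \<le> val i ?X")
          case True
          then obtain i where i: "i \<in> L" "mu i \<le> val i ?X" by blast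
          have "sat (L - {i}) (G - ?X)"
            using Suc.prems i X c2 4 by (intro Suc.IH feas_spare_two[OF e lt]) (auto simp: card_Diff_subset simp del: insert_subset)
          then have "sat (insert i (L - {i})) G" by (rule sat_insert[OF _ X i(2)])
          then show ?thesis using i(1) by (simp add: insert_absorb)
        next
          case False
          let ?H = "e ` {..<n}"
          have cH: "card ?H = n"
            using strict_mono_on_imp_inj_on[OF e(1)] lt by (subst card_image) (auto intro: inj_on_subset)
          have out: "val i {x, y} < mu i" if i: "i \<in> L" and xy: "x \<in> G" "y \<in> G" "x \<notin> ?H" "x < y" for i x y
          proof -
            obtain s t where st: "s < card G" "x = e s" "t < card G" "y = e t" using xy e(2) by blast
            have "n \<le> s" "s < t" using st xy less by (force simp: not_less[symmetric])+
            then have "e n \<le> x" "e (Suc n) \<le> y" using st strict_mono_on_leD[OF e(1)] by simp_all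
            then have "dominates ?X {x, y}"
              using less[of n "Suc n"] lt xy(4) by (intro dominates_pair) auto
            then have "val i {x, y} \<le> val i ?X" by (rule val_dominates) simp
            then show ?thesis using False i by fastforce
          qed
          \<comment> \<open>There are at least \<open>3 * Suc n - (n + 6) = 2 * n - 3\<close> pairs,
            but \<open>?H\<close> has only \<open>n\<close> goods: a contradiction for
            \<open>n = 4\<close>, and all of \<open>?H\<close> occurs for
            \<open>n = 3\<close>.\<close>
          have tops: "\<exists>T\<subseteq>?H. 2 * n - 3 \<le> card T \<and> (\<forall>a\<in>T. ptop i (Suc n) G a 1)" if i: "i \<in> L" for i
          proof -
            have "rich i (Suc n) G (3 * Suc n - card G)"
              using reject_rich(1)[OF Suc.prems(5)[OF i] ne rej[OF i]] .
            then have "\<exists>T\<subseteq>?H. 3 * Suc n - card G \<le> card T \<and> (\<forall>a\<in>T. ptop i (Suc n) G a (3 * Suc n - card G))"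
              by (rule rich_tops) (rule out[OF i])
            then obtain T where T: "T \<subseteq> ?H" "3 * Suc n - card G \<le> card T"
              "\<And>a. a \<in> T \<Longrightarrow> ptop i (Suc n) G a (3 * Suc n - card G)" by blast
            have "1 \<le> 3 * Suc n - card G" "2 * n - 3 \<le> 3 * Suc n - card G" using Suc.prems(4) n by auto
            moreover have "ptop i (Suc n) G a 1" if "a \<in> T" for a
              using T(3)[OF that] \<open>1 \<le> 3 * Suc n - card G\<close> unfolding ptop_def by (meson order_trans)
            ultimately show ?thesis using T(1,2) by (intro exI[of _ T]) auto
          qed
          have "n = 3"
          proof (rule ccontr)
            assume "n \<noteq> 3"
            with n have "n = 4" by simp
            obtain T where "T \<subseteq> ?H" "2 * n - 3 \<le> card T" using tops[OF l] by blast
            then show False using card_mono[of ?H T] cH \<open>n = 4\<close> by simp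
          qed
          have top0: "ptop i (Suc n) G (e 0) 1" if i: "i \<in> L" for i
          proof -
            obtain T where T: "T \<subseteq> ?H" "2 * n - 3 \<le> card T" "\<forall>a\<in>T. ptop i (Suc n) G a 1" using tops[OF i] by blast
            then have "T = ?H" using card_seteq[of ?H T] cH \<open>n = 3\<close> by simp
            then show ?thesis using T(3) \<open>n = 3\<close> by auto
          qed
          show ?thesis
          proof (rule reduce_top[OF Suc.prems(1) subset_refl _ _ Suc.prems(5) top0])
            fix i G' assume "i \<in> L" "finite G'" "card G' = card G - 2" "\<And>j. j \<in> L - {i} \<Longrightarrow> feas j n G'"
            then show "sat (L - {i}) G'" using Suc.prems by (intro Suc.IH) auto
          qed (use l 4 in auto)
        qed
      qed
    qed
  qed
qed

end

subsection \<open>Four and eight agents\<close>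

context ordered_goods
begin

text \<open>At least eight pairs over three better goods: three agents share some \<open>a\<close>.
  Removing \<open>a\<close> with a partner leaves three agents and eight goods.\<close>

lemma four_rich:
  assumes "card Q = 4" "card G = 10" "\<And>i. i \<in> Q \<Longrightarrow> rich i 4 G 2" "finite H" "card H \<le> 3"
    "\<And>i x y. i \<in> Q \<Longrightarrow> x \<in> G \<Longrightarrow> y \<in> G \<Longrightarrow> x \<notin> H \<Longrightarrow> x < y \<Longrightarrow> val i {x, y} < mu i"
  shows "sat Q G"
proof -
  have finQ: "finite Q" using assms(1) by (metis card.infinite zero_neq_numeral)
  have "\<forall>i\<in>Q. \<exists>T\<subseteq>H. 2 \<le> card T \<and> (\<forall>a\<in>T. ptop i 4 G a 2)"
    using rich_tops[OF assms(3) assms(6)] by blast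
  then obtain T where T: "\<forall>i\<in>Q. T i \<subseteq> H \<and> 2 \<le> card (T i) \<and> (\<forall>a\<in>T i. ptop i 4 G a 2)"
    by (rule bchoice[THEN exE])
  have "\<exists>a\<in>H. 2 < card {i\<in>Q. a \<in> T i}"
    by (rule popular[OF finQ assms(4), of T 2 2]) (use T assms(1,5) in auto)
  then obtain a where a: "2 < card {i\<in>Q. a \<in> T i}" by blast
  have c: "card (Q - {i\<in>Q. a \<in> T i}) \<le> 1"
    using a assms(1) finQ by (subst card_Diff_subset) auto
  show ?thesis
  proof (rule reduce_top[where K = "{i\<in>Q. a \<in> T i}" and n = 3 and a = a and p = 2, OF finQ _ _ c])
    show "{i\<in>Q. a \<in> T i} \<noteq> {}" using a by (metis card.empty not_less_zero)
    fix i G' assume "i \<in> Q" "finite G'" "card G' = card G - 2" "\<And>j. j \<in> Q - {i} \<Longrightarrow> feas j 3 G'"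
    then show "sat (Q - {i}) G'" using assms(1,2) finQ by (intro sat_small[where n = 3]) auto
  qed (use rich_feas[OF assms(3)] T in \<open>auto simp: numeral_eq_Suc\<close>)
qed

text \<open>After \<open>a\<close> and a partner leave, three agents and nine goods remain, and at
  least two of the agents still have a pair, as \<open>two_pairs_sat\<close> requires.\<close>

lemma four_nine:
  assumes "card Q = 4" "card G = 11" "\<And>i. i \<in> Q \<Longrightarrow> feas i 4 G" "K \<subseteq> Q" "3 \<le> card K"
    "\<And>i. i \<in> K \<Longrightarrow> ptop i 4 G a 2"
  shows "sat Q G"
proof -
  have finQ: "finite Q" using assms(1) by (metis card.infinite zero_neq_numeral)
  have finK: "finite K" using assms(4) finQ by (rule finite_subset)
  have c: "card (Q - K) \<le> 1" using assms(1,4,5) finK by (simp add: card_Diff_subset)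
  show ?thesis
  proof (rule reduce_top[where K = K and n = 3 and a = a and p = 2, OF finQ assms(4) _ c])
    show "K \<noteq> {}" using assms(5) by auto
    fix i G' assume i: "i \<in> Q" "\<And>j. j \<in> Q - {i} \<Longrightarrow> feas j 3 G'" "\<And>j. j \<in> K - {i} \<Longrightarrow> rich j 3 G' (2 - 1)"
    have "2 \<le> card (K - {i})" using assms(5) diff_card_le_card_Diff[of "{i}" K] by simp
    then obtain x y where xy: "x \<in> K - {i}" "y \<in> K - {i}" "x \<noteq> y"
      by (metis card_le_Suc0_iff_eq finK finite_Diff not_less_eq_eq numeral_2_eq_2)
    show "sat (Q - {i}) G'"
      by (rule two_pairs_sat[of _ _ x y]) (use i xy assms(1,4) finQ in auto)
  qed (use assms(3,6) in \<open>auto simp: numeral_eq_Suc\<close>)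
qed

text \<open>For each \<open>a\<close> at most three agents have a pair with better good \<open>a\<close>, and at most two of them
  have no other pair: otherwise giving \<open>a\<close> away leaves a three agent problem that is solvable.
  Double counting the pairs of eight agents over the at most three goods of \<open>H\<close> contradicts this.\<close>
lemma eight_agents:
  assumes "card A = 8" "card G = 11" "\<And>i. i \<in> A \<Longrightarrow> feas i 4 G"
    "\<And>i g. i \<in> A \<Longrightarrow> g \<in> G \<Longrightarrow> v i g < mu i" "finite H" "card H \<le> 3"
    "\<And>i x y. i \<in> A \<Longrightarrow> x \<in> G \<Longrightarrow> y \<in> G \<Longrightarrow> x \<notin> H \<Longrightarrow> x < y \<Longrightarrow> val i {x, y} < mu i"
  shows "\<exists>Q\<subseteq>A. card Q = 4 \<and> sat Q G"
proof (rule ccontr)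
  assume no: "\<not> ?thesis"
  have finA: "finite A" using assms(1) by (metis card.infinite zero_neq_numeral)
  have neG: "G \<noteq> {}" and finG: "finite G" using assms(2) by (auto intro: card_ge_0_finite)
  have "\<forall>i\<in>A. \<exists>p. card (fst p) = 4 \<and> part i (fst p) G (snd p)"
    using assms(3) unfolding feas_def by (metis fst_conv snd_conv)
  then obtain p where p: "\<forall>i\<in>A. card (fst (p i)) = 4 \<and> part i (fst (p i)) G (snd (p i))"
    by (rule bchoice[THEN exE])
  define I where "I = fst \<circ> p"
  define f where "f = snd \<circ> p"
  have I: "card (I i) = 4" "part i (I i) G (f i)" if "i \<in> A" for i
    using p that by (auto simp: I_def f_def)
  define P where "P i = {k\<in>I i. card (share (f i) G k) = 2}" for i
  have ge2: "2 \<le> card (share (f i) G k)" if "i \<in> A" "k \<in> I i" for i k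
    using reject_rich(3)[OF assms(3)[OF that(1)] neG assms(4)[OF that(1)] I(2)[OF that(1)] that(2)] .
  have finI: "finite (I i)" if "i \<in> A" for i using partD(1)[OF I(2)[OF that]] .
  have P1: "1 \<le> card (P i)" if i: "i \<in> A" for i
  proof (rule ccontr)
    assume "\<not> ?thesis"
    then have "card (P i) = 0" by simp
    moreover have "finite (P i)" using finI[OF i] by (simp add: P_def)
    ultimately have "P i = {}" by simp
    then have "3 \<le> card (share (f i) G k)" if "k \<in> I i" for k
      using ge2[OF i that] that unfolding P_def by fastforce
    then have "(\<Sum>k\<in>I i. 3) \<le> (\<Sum>k\<in>I i. card (share (f i) G k))" by (intro sum_mono)
    then show False using I[OF i] assms(2) by (simp add: part_card)
  qed
  have "\<forall>i\<in>A. \<exists>T\<subseteq>H. card T = card (P i) \<and> (\<forall>a\<in>T. \<exists>k\<in>I i. \<exists>b. share (f i) G k = {a, b} \<and> a < b)"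
    unfolding P_def using part_tops[OF I(2) assms(7)] by blast
  then obtain T where T: "\<forall>i\<in>A. T i \<subseteq> H \<and> card (T i) = card (P i) \<and>
      (\<forall>a\<in>T i. \<exists>k\<in>I i. \<exists>b. share (f i) G k = {a, b} \<and> a < b)"
    by (rule bchoice[THEN exE])
  have few: "card {i\<in>A. a \<in> T i} \<le> 3 \<and> card {i\<in>A. a \<in> T i \<and> card (P i) = 1} \<le> 2" for a
  proof (cases "{i\<in>A. a \<in> T i} = {}")
    case True
    then have "{i\<in>A. a \<in> T i \<and> card (P i) = 1} = {}" by blast
    with True show ?thesis by (simp only: card.empty zero_le simp_thms)
  next
    case False
    then obtain j k c where j: "j \<in> A" "k \<in> I j" "share (f j) G k = {a, c}" "a < c" using T by blast
    have aG: "a \<in> G" "c \<in> G" using j(3) share_subset by blast+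
    have acc: "mu j \<le> val j {a, c}" using partD(4)[OF I(2)[OF j(1)] j(2)] j(3) by simp
    obtain b l where b: "b \<in> G" "a < b" "l \<in> A" "mu l \<le> val l {a, b}"
      "\<And>i d. i \<in> A \<Longrightarrow> d \<in> G \<Longrightarrow> a < d \<Longrightarrow> mu i \<le> val i {a, d} \<Longrightarrow> d \<le> b"
      using best_pair[OF finA finG j(1) aG(2) j(4) acc] by blast
    let ?G = "G - {a, b}"
    have G9: "card ?G = 9" using aG(1) b(1,2) finG assms(2) by (simp add: card_Diff_subset)
    \<comment> \<open>\<open>N\<close> collects agents who can still form three bundles: they lose
      just their pair with \<open>a\<close>, or they can merge. All others value
      \<open>{a, b}\<close> above their share.\<close>
    define N where "N = {i\<in>A. a \<in> T i \<or> val i {a, b} \<le> mu i}"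
    have keep: "\<exists>f'. part i (I i - {k}) ?G f' \<and> (\<forall>l\<in>I i - {k}. card (share f' ?G l) = card (share (f i) G l))"
      if i: "i \<in> A" "k \<in> I i" "share (f i) G k = {a, d}" "a < d" for i k d
    proof -
      have "d \<in> G" using i(3) share_subset by blast
      moreover have "mu i \<le> val i {a, d}" using partD(4)[OF I(2)[OF i(1)] i(2)] i(3) by simp
      ultimately have "d \<le> b" using b(5) i(1,4) by blast
      moreover have "card (I i) = Suc 3" using I(1)[OF i(1)] by simp
      ultimately obtain f' where "part i (I i - {k}) ?G f'"
        "\<And>l. l \<in> I i - {k} \<Longrightarrow> card (share f' ?G l) = card (share (f i) G l)"
        using keep_top[OF I(2)[OF i(1)] i(2-4) _ b(1) _ zero_less_numeral] by blast
      then show ?thesis by blast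
    qed
    have feasN: "feas i 3 ?G" if "i \<in> N" for i
    proof (cases "a \<in> T i")
      case True
      have i: "i \<in> A" using that by (simp add: N_def)
      obtain k d where k: "k \<in> I i" "share (f i) G k = {a, d}" "a < d" using T i True by blast
      obtain f' where "part i (I i - {k}) ?G f'" using keep[OF i k] by blast
      moreover have "card (I i - {k}) = 3" using I(1)[OF i] k(1) by simp
      ultimately show ?thesis unfolding feas_def by blast
    next
      case False
      then have "i \<in> A" "val i {a, b} \<le> mu i" using that by (auto simp: N_def)
      then show ?thesis using feas_merge_pair[of i 3 G a b] assms(3) aG(1) b(1) by (simp add: numeral_eq_Suc)
    qed
    have nosat: False if "L \<subseteq> A - {l}" "card L = 3" "sat L ?G" "l \<in> A" "mu l \<le> val l {a, b}" for L l
    proof -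
      have "sat (insert l L) G" by (rule sat_insert[OF that(3) _ that(5)]) (use aG b in auto)
      moreover have "finite L" using that(1) finA by (meson finite_Diff finite_subset)
      ultimately show False using no that by (metis Diff_iff card_insert_disjoint eval_nat_numeral(2) insert_subset semiring_norm(26) semiring_norm(27) singletonI subset_Diff_insert subset_iff)
    qed
    \<comment> \<open>Otherwise \<open>l\<close> takes \<open>{a, b}\<close>, and the other seven
      agents are more than the four that nine goods call for.\<close>
    have NA: "N \<noteq> A"
    proof
      assume "N = A"
      then obtain L where "L \<subseteq> A - {l}" "card L = 3" "sat L ?G"
        using three_sat[of "A - {l}" ?G] feasN G9 finA assms(1) b(3) by auto
      then show False using nosat b(3,4) by blast
    qed
    then obtain q where q: "q \<in> A" "q \<notin> N" unfolding N_def by blast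
    then have accq: "mu q \<le> val q {a, b}" by (auto simp: N_def)
    have NsubA: "N \<subseteq> A - {q}" using q by (auto simp: N_def)
    then have finN: "finite N" using finA by (meson finite_Diff finite_subset)
    \<comment> \<open>\<open>q\<close> takes \<open>{a, b}\<close> without being in
      \<open>N\<close>, so four agents in \<open>N\<close> would already suffice.\<close>
    have "card N \<le> 3"
    proof (rule ccontr)
      assume "\<not> card N \<le> 3"
      then obtain L where "L \<subseteq> N" "card L = 3" "sat L ?G"
        using three_sat[of N ?G] feasN G9 finN by auto
      then show False using nosat[of L q] NsubA q(1) accq by blast
    qed
    moreover have "card {i\<in>A. a \<in> T i} \<le> card N" using finN by (intro card_mono) (auto simp: N_def)
    moreover have "card {i\<in>A. a \<in> T i \<and> card (P i) = 1} \<le> 2"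
    proof (rule ccontr)
      assume "\<not> ?thesis"
      then have "3 \<le> card {i\<in>A. a \<in> T i \<and> card (P i) = 1}" by linarith
      then obtain L where L: "L \<subseteq> {i\<in>A. a \<in> T i \<and> card (P i) = 1}" "card L = 3"
        by (rule obtain_subset_with_card_n)
      \<comment> \<open>Having lost their only pair, these agents have three bundles of at least
        three goods on nine goods: triples throughout.\<close>
      have "sat L ?G"
      proof (rule three_triples_sat[OF L(2) G9])
        fix i assume iL: "i \<in> L"
        then have i: "i \<in> A" "a \<in> T i" "card (P i) = 1" using L(1) by auto
        obtain k d where k: "k \<in> I i" "share (f i) G k = {a, d}" "a < d" using T i by blast
        obtain f' where f': "part i (I i - {k}) ?G f'"
          "\<And>l. l \<in> I i - {k} \<Longrightarrow> card (share f' ?G l) = card (share (f i) G l)" using keep[OF i(1) k] by blast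
        have kP: "k \<in> P i" using k by (simp add: P_def)
        have P: "P i = {k}" using i(3) kP by (metis card_1_singletonE singletonD)
        have ge3: "3 \<le> card (share f' ?G l)" if l: "l \<in> I i - {k}" for l
        proof -
          have "card (share (f i) G l) \<noteq> 2" using l P by (auto simp: P_def)
          then show ?thesis using ge2[OF i(1), of l] l f'(2)[OF l] by simp
        qed
        have c3: "card (I i - {k}) = 3" using I(1)[OF i(1)] k(1) by simp
        have "card (share f' ?G l) = 3" if l: "l \<in> I i - {k}" for l
        proof -
          have fin: "finite (I i - {k})" using finI[OF i(1)] by simp
          have "(\<Sum>d\<in>I i - {k} - {l}. 3) \<le> (\<Sum>d\<in>I i - {k} - {l}. card (share f' ?G d))"
            using ge3 by (intro sum_mono) auto
          moreover have "card (I i - {k} - {l}) = 2" using c3 l fin by simp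
          moreover have "card ?G = card (share f' ?G l) + (\<Sum>d\<in>I i - {k} - {l}. card (share f' ?G d))"
            unfolding part_card[OF f'(1), symmetric] by (rule sum.remove[OF fin l])
          ultimately have "card (share f' ?G l) \<le> 3" using G9 by simp
          then show ?thesis using ge3[OF l] by simp
        qed
        then show "\<exists>I f. card I = 3 \<and> part i I ?G f \<and> (\<forall>k\<in>I. card (share f ?G k) = 3)"
          using f'(1) c3 by blast
      qed
      moreover have "L \<subseteq> A - {q}" using L(1) NsubA by (auto simp: N_def)
      ultimately show False using nosat[of L q] L(2) q(1) accq by blast
    qed
    ultimately show ?thesis by simp
  qed
  \<comment> \<open>At most nine pairs for eight agents with at least one each: seven or more have
    exactly one. But each good of \<open>H\<close> admits only two of those, six in all.\<close>
  let ?S = "{i\<in>A. card (P i) = 1}"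
  have "(\<Sum>i\<in>A. card (T i)) = (\<Sum>a\<in>H. card {i\<in>A. a \<in> T i})"
    using finA assms(5) T by (intro incidence_sum) auto
  also have "\<dots> \<le> (\<Sum>a\<in>H. 3)" using few by (intro sum_mono) blast
  also have "\<dots> \<le> 9" using assms(6) by simp
  finally have "(\<Sum>i\<in>A. card (P i)) \<le> 9" using T by simp
  moreover have "(\<Sum>i\<in>A. 2) \<le> (\<Sum>i\<in>A. card (P i) + (if card (P i) = 1 then 1 else 0))"
    using P1 by (intro sum_mono) fastforce
  moreover have "(\<Sum>i\<in>A. card (P i) + (if card (P i) = 1 then 1 else 0)) = (\<Sum>i\<in>A. card (P i)) + card ?S"
    using finA by (simp add: sum.distrib sum.If_cases Collect_conj_eq)
  ultimately have S7: "7 \<le> card ?S" using assms(1) by simp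
  have "(\<Sum>i\<in>?S. card (T i)) = (\<Sum>a\<in>H. card {i\<in>?S. a \<in> T i})"
    using finA assms(5) T by (intro incidence_sum) auto
  also have "\<dots> \<le> (\<Sum>a\<in>H. 2)"
  proof (rule sum_mono)
    fix a
    have "{i\<in>?S. a \<in> T i} = {i\<in>A. a \<in> T i \<and> card (P i) = 1}" by blast
    then show "card {i\<in>?S. a \<in> T i} \<le> 2" using few[of a] by simp
  qed
  also have "\<dots> \<le> 6" using assms(6) by simp
  finally have "(\<Sum>i\<in>?S. card (T i)) \<le> 6" .
  moreover have "(\<Sum>i\<in>?S. card (T i)) = (\<Sum>i\<in>?S. 1)" using T by (intro sum.cong) auto
  ultimately show False using S7 by simp
qed

end

locale enum_goods = ordered_goods +
  fixes e :: "nat \<Rightarrow> nat" and m :: nat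
  assumes e: "strict_mono_on {..<m} e"
begin

section \<open>The goods that remain after the best ones are set aside\<close>

definition rest :: "nat \<Rightarrow> nat set" where
  "rest k = e ` {k..<m}"

lemma e_less: "s < m \<Longrightarrow> t < m \<Longrightarrow> e s < e t \<longleftrightarrow> s < t"
  using strict_mono_on_less[OF e] by simp

lemma e_le: "s < m \<Longrightarrow> t < m \<Longrightarrow> e s \<le> e t \<longleftrightarrow> s \<le> t"
  using strict_mono_on_less_eq[OF e] by simp

lemma inj_e: "inj_on e {k..<m}"
  by (rule inj_on_subset[OF strict_mono_on_imp_inj_on[OF e]]) auto

lemma finite_rest [simp]: "finite (rest k)"
  by (simp add: rest_def)

lemma card_rest: "card (rest k) = m - k"
  unfolding rest_def using inj_e by (simp add: card_image)

lemma rest_Suc: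
  assumes "k < m"
  shows "rest k - {e k} = rest (Suc k)" "e k \<in> rest k"
proof -
  have "{k..<m} = insert k {Suc k..<m}" using assms by auto
  then have "rest k = insert (e k) (rest (Suc k))" by (simp add: rest_def)
  moreover have "e k \<notin> rest (Suc k)" using e_less[of k] assms unfolding rest_def by fastforce
  ultimately show "rest k - {e k} = rest (Suc k)" "e k \<in> rest k" by auto
qed

lemma feas_rest_Suc: "feas i (Suc n) (rest k) \<Longrightarrow> k < m \<Longrightarrow> 0 < n \<Longrightarrow> feas i n (rest (Suc k))"
  using feas_drop[of i n "rest k" "e k"] rest_Suc[of k] by simp

lemma feas_rest: "feas i (n + k) (rest 0) \<Longrightarrow> k < m \<Longrightarrow> 0 < n \<Longrightarrow> feas i n (rest k)"
proof (induction k arbitrary: n)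
  case (Suc k)
  then have "feas i (Suc n) (rest k)" by simp
  then show ?case using Suc.prems feas_rest_Suc by simp
qed simp

lemma rejects_rest:
  assumes "v i (e k) < mu i" "g \<in> rest k"
  shows "v i g < mu i"
proof -
  obtain s where s: "k \<le> s" "s < m" "g = e s" using assms(2) by (auto simp: rest_def)
  then have "e k \<le> g" using e_le[of k s] by simp
  then show ?thesis using anti[of "e k" g i] assms(1) by linarith
qed

lemma rich_rest:
  assumes "v i (e k) < mu i" "k < m" "feas i n (rest k)"
  shows "rich i n (rest k) (3 * n - (m - k))"
proof -
  have "rest k \<noteq> {}" using rest_Suc[OF assms(2)] by blast
  then show ?thesis using reject_rich(1)[OF assms(3)] rejects_rest[OF assms(1)] card_rest by simp
qed

text \<open>Pairs whose better good is \<open>e r\<close> or worse are dominated by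
  \<open>{e r, e (Suc r)}\<close>.\<close>

lemma weak_pair:
  assumes "val i {e r, e (Suc r)} < mu i" "Suc r < m" "x \<in> rest 0" "y \<in> rest 0" "x \<notin> e ` {..<r}" "x < y"
  shows "val i {x, y} < mu i"
proof -
  obtain s t where st: "s < m" "x = e s" "t < m" "y = e t" using assms(3,4) by (auto simp: rest_def)
  have "r \<le> s" using assms(5) st(2) by (meson imageI lessThan_iff not_less)
  moreover have "s < t" using st assms(6) e_less by simp
  ultimately have "e r \<le> x" "e (Suc r) \<le> y" using st assms(2) by (simp_all add: e_le)
  moreover have "e r < e (Suc r)" using e_less assms(2) by simp
  ultimately have "dominates {e r, e (Suc r)} {x, y}"
    using assms(6) by (intro dominates_pair[of "e r" _ "e (Suc r)"]) auto
  then have "val i {x, y} \<le> val i {e r, e (Suc r)}" by (rule val_dominates) simp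
  then show ?thesis using assms(1) by linarith
qed

lemma weak_pair_rest:
  assumes "val i {e r, e (Suc r)} < mu i" "Suc r < m" "x \<in> rest k" "y \<in> rest k" "x \<notin> e ` {k..<r}" "x < y"
  shows "val i {x, y} < mu i"
proof (rule weak_pair[OF assms(1,2) _ _ _ assms(6)])
  show "x \<in> rest 0" "y \<in> rest 0" using assms(3,4) by (auto simp: rest_def)
  obtain s where s: "k \<le> s" "s < m" "x = e s" using assms(3) by (auto simp: rest_def)
  show "x \<notin> e ` {..<r}"
  proof
    assume "x \<in> e ` {..<r}"
    then obtain t where t: "t < r" "x = e t" by auto
    then have "s = t" using s e_less[of s t] e_less[of t s] assms(2) by simp
    then show False using s t assms(5) by auto
  qed
qed

lemma tops_rest:
  assumes "val i {e r, e (Suc r)} < mu i" "Suc r < m" "rich i n (rest k) p"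
  shows "\<exists>T\<subseteq>e ` {k..<r}. p \<le> card T \<and> (\<forall>a\<in>T. ptop i n (rest k) a p)"
  by (rule rich_tops[OF assms(3)]) (rule weak_pair_rest[OF assms(1,2)])

lemma card_e: "b \<le> m \<Longrightarrow> card (e ` {a..<b}) = b - a"
  using inj_on_subset[OF inj_e[of a], of "{a..<b}"] by (simp add: card_image)

text \<open>Only \<open>r - k\<close> goods can be better goods of pairs; with that many pairs each
  of them occurs, in particular \<open>e k\<close>.\<close>

lemma all_tops_rest:
  assumes "val i {e r, e (Suc r)} < mu i" "Suc r < m" "rich i n (rest k) p" "r - k \<le> p" "k < r"
  shows "ptop i n (rest k) (e k) p"
proof -
  obtain T where T: "T \<subseteq> e ` {k..<r}" "p \<le> card T" "\<forall>a\<in>T. ptop i n (rest k) a p"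
    using tops_rest[OF assms(1-3)] by blast
  have "T = e ` {k..<r}"
    by (rule card_seteq) (use T assms card_e[of r k] in auto)
  then show ?thesis using T(3) assms(5) by auto
qed

text \<open>The early goods are handed out from the last to the first.\<close>
lemma serve:
  assumes "sat L (rest k)" "k \<le> m" "finite S" "card S = k"
    and "\<And>t. t < k \<Longrightarrow> card {i\<in>S. v i (e t) < mu i} \<le> t"
  shows "sat (L \<union> S) (rest 0)"
  using assms
proof (induction k arbitrary: L S)
  case 0
  then show ?case by simp
next
  case (Suc k)
  \<comment> \<open>At most \<open>k\<close> of the \<open>k + 1\<close> waiting agents reject
    \<open>e k\<close>, so one accepts it.\<close>
  have "card {i\<in>S. v i (e k) < mu i} \<le> k" using Suc.prems(5) by simp
  then have "{i\<in>S. v i (e k) < mu i} \<noteq> S" using Suc.prems(4) by auto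
  then obtain u where u: "u \<in> S" "mu u \<le> v u (e k)" by force
  have k: "k < m" using Suc.prems(2) by simp
  have "sat (insert u L) (rest k)"
    by (rule sat_insert[of L "rest k" "{e k}"]) (use Suc.prems(1) rest_Suc[OF k] u in \<open>auto simp: val_def\<close>)
  then have "sat (insert u L \<union> (S - {u})) (rest 0)"
  proof (rule Suc.IH)
    fix t assume t: "t < k"
    have "card {i\<in>S - {u}. v i (e t) < mu i} \<le> card {i\<in>S. v i (e t) < mu i}"
      using Suc.prems(3) by (intro card_mono) auto
    also have "\<dots> \<le> t" using Suc.prems(5) t by simp
    finally show "card {i\<in>S - {u}. v i (e t) < mu i} \<le> t" .
  qed (use Suc.prems u k in auto)
  moreover have "insert u L \<union> (S - {u}) = L \<union> S" using u by auto
  ultimately show ?case by simp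
qed

end

subsection \<open>Eight agents and fifteen goods\<close>

context enum_goods
begin

section \<open>Agents who reject an early good\<close>

definition rej :: "nat set \<Rightarrow> nat \<Rightarrow> nat set" where
  "rej L t = {i\<in>L. v i (e t) < mu i}"

lemma rej_subset: "rej L t \<subseteq> L"
  by (auto simp: rej_def)

lemma rej_mono: "s \<le> t \<Longrightarrow> t < m \<Longrightarrow> rej L s \<subseteq> rej L t"
  using rejects_rest[of _ s "e t"] by (auto simp: rej_def rest_def)

lemma feas_spare_rest:
  assumes "feas i (Suc n) (rest 0)" "Suc n < m" "0 < n"
  shows "feas i n (rest 0 - {e n, e (Suc n)})"
proof -
  have c: "card (rest 0) = m" by (simp add: card_rest)
  show ?thesis
    by (rule feas_spare_two[unfolded c]) (use e c assms in \<open>auto simp: rest_def lessThan_atLeast0\<close>)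
qed

text \<open>Rejecting \<open>e k\<close> would produce more pairs on \<open>rest k\<close> than
  there are possible better goods.\<close>

lemma accepts_early:
  assumes "feas i n (rest 0)" "val i {e r, e (Suc r)} < mu i" "Suc r < m" "k < n"
    "r - k < 3 * (n - k) - (m - k)" "k < m"
  shows "mu i \<le> v i (e k)"
proof (rule ccontr)
  assume "\<not> ?thesis"
  moreover have "feas i (n - k) (rest k)" using feas_rest[of i "n - k" k] assms by simp
  ultimately have "rich i (n - k) (rest k) (3 * (n - k) - (m - k))"
    using rich_rest[OF _ assms(6)] by simp
  from tops_rest[OF assms(2,3) this] obtain T where
    T: "T \<subseteq> e ` {k..<r}" "3 * (n - k) - (m - k) \<le> card T" by blast
  have "card T \<le> card (e ` {k..<r})" using T(1) by (intro card_mono) auto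
  then show False using T(2) card_e[of r k] assms(3,5) by simp
qed

lemma serve_rest:
  assumes "sat Q (rest k)" "Q \<subseteq> L" "finite L" "card L = card Q + k" "k \<le> m"
    "\<And>t. t < k \<Longrightarrow> card (rej L t - Q) \<le> t"
  shows "sat L (rest 0)"
proof -
  have "card (L - Q) = k" using assms(2-4) by (simp add: card_Diff_subset finite_subset)
  moreover have "{i\<in>L - Q. v i (e t) < mu i} = rej L t - Q" for t by (auto simp: rej_def)
  ultimately have "sat (Q \<union> (L - Q)) (rest 0)" using assms by (intro serve) auto
  then show ?thesis using assms(2) by (simp add: Un_absorb1)
qed

lemma sat_give_pair:
  assumes "u \<in> L" "mu u \<le> val u {e r, e (Suc r)}" "Suc r < m"
    "sat (L - {u}) (rest 0 - {e r, e (Suc r)})"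
  shows "sat L (rest 0)"
proof -
  have "sat (insert u (L - {u})) (rest 0)"
    by (rule sat_insert[OF assms(4) _ assms(2)]) (use assms(3) in \<open>auto simp: rest_def\<close>)
  then show ?thesis using assms(1) by (simp add: insert_absorb)
qed

lemma card_rest_pair: "Suc r < m \<Longrightarrow> card (rest 0 - {e r, e (Suc r)}) = m - 2"
proof -
  assume r: "Suc r < m"
  then have "{e r, e (Suc r)} \<subseteq> rest 0" by (auto simp: rest_def)
  then show ?thesis using e_less[of r "Suc r"] r by (simp add: card_Diff_subset card_rest)
qed

text \<open>Rejecting \<open>e k\<close> yields \<open>8 - 2k\<close> pairs over
  \<open>6 - k\<close> better goods: impossible for \<open>k\<close> up to 1 and tight for
  \<open>k = 2\<close>.\<close>

lemma seven_thirteen: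
  assumes m: "m = 13" and L: "card L = 7" and feas: "\<And>i. i \<in> L \<Longrightarrow> feas i 7 (rest 0)"
  shows "sat L (rest 0)"
proof (cases "\<exists>u\<in>L. mu u \<le> val u {e 6, e (Suc 6)}")
  case True
  then obtain u where u: "u \<in> L" "mu u \<le> val u {e 6, e (Suc 6)}" by blast
  have finL: "finite L" using L by (metis card.infinite zero_neq_numeral)
  have "sat (L - {u}) (rest 0 - {e 6, e (Suc 6)})"
  proof (rule sat_small[where n = 6])
    fix i assume "i \<in> L - {u}"
    then have "feas i (Suc 6) (rest 0)" using feas by simp
    then show "feas i 6 (rest 0 - {e 6, e (Suc 6)})" by (rule feas_spare_rest) (use m in auto)
  qed (use L finL u card_rest_pair[of 6] m finite_rest[of 0] in auto)
  then show ?thesis using sat_give_pair[OF u] m by simp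
next
  case False
  then have weak: "val i {e 6, e (Suc 6)} < mu i" if "i \<in> L" for i using that by force
  have finL: "finite L" using L by (metis card.infinite zero_neq_numeral)
  have cr: "card (rest k) = 13 - k" for k using card_rest m by simp
  have lev: "feas i n (rest k)" if "i \<in> L" "n + k = 7" "0 < n" for i n k
    using feas_rest[of i n k] feas[OF that(1)] that(2,3) m by simp
  have R0: "rej L 0 = {}" using accepts_early[OF feas weak, of _ 0] m by (force simp: rej_def)
  have R1: "rej L 1 = {}" using accepts_early[OF feas weak, of _ 1] m by (force simp: rej_def)
  have finR: "finite (rej L t)" for t using finite_subset[OF rej_subset finL] .
  consider "rej L 2 = L" | "rej L 2 \<noteq> L" "4 \<le> card (rej L 3)" | "card (rej L 3) \<le> 3" by linarith
  then show ?thesis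
  proof cases
    case 1
    obtain Q where Q: "Q \<subseteq> L" "card Q = 5" using obtain_subset_with_card_n[of 5 L] L by auto
    have finQ: "finite Q" using Q(1) finL by (rule finite_subset)
    have top: "ptop i (Suc 4) (rest 2) (e 2) 4" if "i \<in> Q" for i
    proof -
      have i: "i \<in> L" "v i (e 2) < mu i" using that Q(1) 1 by (auto simp: rej_def)
      have "rich i 5 (rest 2) 4" using rich_rest[OF i(2) _ lev[OF i(1), of 5]] m by simp
      then show ?thesis using all_tops_rest[OF weak[OF i(1)], of 5 2 4] m by simp
    qed
    have "sat Q (rest 2)"
    proof (rule reduce_top[OF finQ subset_refl _ _ _ top])
      fix i G' assume "i \<in> Q" "finite G'" "card G' = card (rest 2) - 2" "\<And>j. j \<in> Q - {i} \<Longrightarrow> feas j 4 G'"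
      then show "sat (Q - {i}) G'" using Q finQ cr by (intro sat_small[where n = 4]) auto
    qed (use Q lev[of _ 5 2] in auto)
    then show ?thesis
    proof (rule serve_rest[OF _ Q(1) finL])
      fix t :: nat assume "t < 2"
      then have "t = 0 \<or> t = 1" by linarith
      then show "card (rej L t - Q) \<le> t" using R0 R1 by auto
    qed (use Q L m in auto)
  next
    case 2
    \<comment> \<open>\<open>u\<close> stays out of \<open>Q\<close> and can take
      \<open>e 2\<close>, so at most two of the three waiting agents reject
      \<open>e 2\<close>.\<close>
    obtain u where u: "u \<in> L" "u \<notin> rej L 2" "4 \<le> card (rej L 3 - {u})"
    proof (cases "rej L 3 = L")
      case True
      obtain u where "u \<in> L" "u \<notin> rej L 2" using 2(1) rej_subset by blast
      with that show ?thesis using True L finL by simp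
    next
      case False
      then obtain u where "u \<in> L" "u \<notin> rej L 3" using rej_subset by blast
      moreover from this have "u \<notin> rej L 2" using rej_mono[of 2 3 L] m by auto
      moreover have "rej L 3 - {u} = rej L 3" using \<open>u \<notin> rej L 3\<close> by simp
      ultimately show ?thesis using that 2(2) by simp
    qed
    obtain Q where Q: "Q \<subseteq> rej L 3 - {u}" "card Q = 4" using obtain_subset_with_card_n[OF u(3)] by blast
    have QL: "Q \<subseteq> L" using Q(1) rej_subset by blast
    have "sat Q (rest 3)"
    proof (rule four_rich[of Q "rest 3" "e ` {3..<6}", OF Q(2)])
      fix i assume "i \<in> Q"
      then have i: "i \<in> L" "v i (e 3) < mu i" using Q(1) by (auto simp: rej_def)
      show "rich i 4 (rest 3) 2" using rich_rest[OF i(2) _ lev[OF i(1), of 4]] m by simp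
      fix x y assume "x \<in> rest 3" "y \<in> rest 3" "x \<notin> e ` {3..<6}" "x < y"
      then show "val i {x, y} < mu i" using weak_pair_rest[OF weak[OF i(1)]] m by simp
    qed (use m cr card_e in \<open>auto simp: card_e\<close>)
    then show ?thesis
    proof (rule serve_rest[OF _ QL finL])
      fix t :: nat assume "t < 3"
      then have "t = 0 \<or> t = 1 \<or> t = 2" by linarith
      moreover have "card (rej L 2 - Q) \<le> card (L - Q - {u})"
        using u finL rej_subset by (intro card_mono) auto
      moreover have "card (L - Q - {u}) = 2"
        using u Q L QL finL finite_subset[OF QL finL] by (subst card_Diff_singleton) (auto simp: card_Diff_subset)
      ultimately show "card (rej L t - Q) \<le> t" using R0 R1 by auto
    qed (use Q L m in auto)
  next
    case 3
    \<comment> \<open>Four candidates suffice for nine goods. They include all who reject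
      \<open>e 3\<close>, and one of them is left over, so at most one waiting agent rejects any of
      the early goods.\<close>
    obtain N where N: "rej L 3 \<subseteq> N" "N \<subseteq> L" "card N = 4"
      using exists_subset_between[of "rej L 3" 4 L] 3 L finL rej_subset by auto
    have finN: "finite N" using N(2) finL by (rule finite_subset)
    have "\<exists>Q\<subseteq>N. card Q = 3 \<and> sat Q (rest 4)"
      using N lev[of _ 3 4] by (intro three_sat[OF finN]) (auto simp: cr)
    then obtain Q where Q: "Q \<subseteq> N" "card Q = 3" "sat Q (rest 4)" by blast
    have QL: "Q \<subseteq> L" using Q N by blast
    show ?thesis
    proof (rule serve_rest[OF Q(3) QL finL])
      fix t :: nat assume t: "t < 4"
      show "card (rej L t - Q) \<le> t"
      proof (cases "t = 0")
        case False
        have "card (rej L t - Q) \<le> card (N - Q)"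
          using N rej_mono[of t 3 L] t m finN by (intro card_mono) auto
        also have "\<dots> = 1" using N Q finN by (simp add: card_Diff_subset finite_subset)
        finally show ?thesis using False by simp
      qed (use R0 in simp)
    qed (use Q L m in auto)
  qed
qed

end

lemma (in ordered_goods) seven_agents:
  assumes "card L = 7" "card G = 13" "\<And>i. i \<in> L \<Longrightarrow> feas i 7 G"
  shows "sat L G"
proof -
  have "finite G" using assms(2) by (auto intro: card_ge_0_finite)
  then obtain e where mono: "strict_mono_on {..<card G} e" and G: "e ` {..<card G} = G" using finite_enum by blast
  interpret enum_goods v mu e 13 by unfold_locales (use mono assms(2) in simp)
  have "rest 0 = G" using G assms(2) by (simp add: rest_def lessThan_atLeast0)
  then show ?thesis using seven_thirteen assms by simp
qed

context enum_goods
begin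

text \<open>Agents who reject \<open>e 2\<close> have five pairs on \<open>rest 2\<close>, those who
  reject \<open>e 3\<close> have three on \<open>rest 3\<close>. Each case finds a solvable group
  \<open>Q\<close> on some \<open>rest k\<close> whose complement can wait.\<close>

lemma eight_fifteen:
  assumes m: "m = 15" and L: "card L = 8" and feas: "\<And>i. i \<in> L \<Longrightarrow> feas i 8 (rest 0)"
  shows "sat L (rest 0)"
proof (cases "\<exists>u\<in>L. mu u \<le> val u {e 7, e (Suc 7)}")
  case True
  then obtain u where u: "u \<in> L" "mu u \<le> val u {e 7, e (Suc 7)}" by blast
  have "sat (L - {u}) (rest 0 - {e 7, e (Suc 7)})"
  proof (rule seven_agents)
    fix i assume "i \<in> L - {u}"
    then have "feas i (Suc 7) (rest 0)" using feas by simp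
    then show "feas i 7 (rest 0 - {e 7, e (Suc 7)})" by (rule feas_spare_rest) (use m in auto)
  qed (use L u card_rest_pair[of 7] m finite_rest[of 0] in auto)
  then show ?thesis using sat_give_pair[OF u] m by simp
next
  case False
  then have weak: "val i {e 7, e (Suc 7)} < mu i" if "i \<in> L" for i using that by force
  have wk: "val i {x, y} < mu i" if "i \<in> L" "x \<in> rest k" "y \<in> rest k" "x \<notin> e ` {k..<7}" "x < y" for i x y k
    using weak_pair_rest[OF weak[OF that(1)] _ that(2-5)] m by simp
  have finL: "finite L" using L by (metis card.infinite zero_neq_numeral)
  have cr: "card (rest k) = 15 - k" for k using card_rest m by simp
  have lev: "feas i n (rest k)" if "i \<in> L" "n + k = 8" "0 < n" for i n k
    using feas_rest[of i n k] feas[OF that(1)] that(2,3) m by simp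
  have R0: "rej L 0 = {}" using accepts_early[OF feas weak, of _ 0] m by (force simp: rej_def)
  have R1: "rej L 1 = {}" using accepts_early[OF feas weak, of _ 1] m by (force simp: rej_def)
  have finR: "finite (rej L t)" for t using finite_subset[OF rej_subset finL] .
  have rich2: "rich i 6 (rest 2) 5" if "i \<in> rej L 2" for i
    using rich_rest[of i 2 6] lev[of i 6 2] that m by (simp add: rej_def)
  have rich3: "rich i 5 (rest 3) 3" if "i \<in> rej L 3" for i
    using rich_rest[of i 3 5] lev[of i 5 3] that m by (simp add: rej_def)
  have early: "card (rej L t - Q) \<le> t" if "t < 2" for t Q
  proof -
    have "t = 0 \<or> t = 1" using that by linarith
    then show ?thesis using R0 R1 by auto
  qed
  consider (i) "6 \<le> card (rej L 2)"
    | (ii) "card (rej L 2) \<le> 5" "rej L 3 = L"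
    | (iii) "3 \<le> card (rej L 2)" "card (rej L 2) \<le> 5" "rej L 3 \<noteq> L"
    | (iv) "card (rej L 2) \<le> 2" "4 \<le> card (rej L 3)" "rej L 3 \<noteq> L"
    | (v) "card (rej L 2) \<le> 2" "card (rej L 3) \<le> 3"
    by linarith
  then show ?thesis
  proof cases
    case i
    \<comment> \<open>Five pairs use all five better goods from \<open>e 2\<close> to
      \<open>e 6\<close>. After \<open>e 2\<close> and a partner leave, four pairs use all of the
      remaining four, so \<open>e 3\<close> can leave in the same way; four agents and nine goods
      remain.\<close>
    obtain Q where Q: "Q \<subseteq> rej L 2" "card Q = 6" using obtain_subset_with_card_n[OF i] by blast
    have QL: "Q \<subseteq> L" using Q(1) rej_subset by blast
    have finQ: "finite Q" using QL finL by (rule finite_subset)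
    have top: "ptop i (Suc 5) (rest 2) (e 2) 5" if "i \<in> Q" for i
    proof -
      have "i \<in> L" using that QL by blast
      then show ?thesis using all_tops_rest[OF weak, of i 6 2 5] rich2 that Q(1) m by auto
    qed
    have "sat Q (rest 2)"
    proof (rule reduce_top[OF finQ subset_refl _ _ _ top])
      fix i G' assume i: "i \<in> Q" "finite G'" "G' \<subseteq> rest 2 - {e 2}" "card G' = card (rest 2) - 2"
        "\<And>j. j \<in> Q - {i} \<Longrightarrow> feas j 5 G'" "\<And>j. j \<in> Q - {i} \<Longrightarrow> rich j 5 G' (5 - 1)"
      have G3: "G' \<subseteq> rest 3" using i(3) rest_Suc(1)[of 2] m by (simp add: numeral_eq_Suc)
      have G11: "card G' = 11" using i(4) cr by simp
      have top': "ptop j (Suc 4) G' (e 3) 4" if j: "j \<in> Q - {i}" for j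
      proof -
        have "\<exists>T\<subseteq>e ` {3..<7}. 4 \<le> card T \<and> (\<forall>a\<in>T. ptop j 5 G' a 4)"
        proof (rule rich_tops)
          show "rich j 5 G' 4" using i(6)[OF j] by simp
          fix x y assume "x \<in> G'" "y \<in> G'" "x \<notin> e ` {3..<7}" "x < y"
          then show "val j {x, y} < mu j" using wk[of j x 3 y] j QL G3 by blast
        qed
        then obtain T where T: "T \<subseteq> e ` {3..<7}" "4 \<le> card T" "\<forall>a\<in>T. ptop j 5 G' a 4" by blast
        have "T = e ` {3..<7}" by (rule card_seteq) (use T card_e[of 7 3] m in auto)
        then show ?thesis using T(3) by simp
      qed
      show "sat (Q - {i}) G'"
      proof (rule reduce_top[OF _ subset_refl _ _ _ top'])
        fix l G'' assume l: "l \<in> Q - {i}" "finite G''" "card G'' = card G' - 2"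
          "\<And>j. j \<in> Q - {i} - {l} \<Longrightarrow> feas j 4 G''"
        then show "sat (Q - {i} - {l}) G''"
          using Q(2) finQ i(1) G11 by (intro sat_small[where n = 4]) auto
      next
        have "card (Q - {i}) = 5" using Q(2) finQ i(1) by simp
        then show "Q - {i} \<noteq> {}" by (metis card.empty zero_neq_numeral)
      qed (use finQ i(5) in auto)
    qed (use Q QL lev[of _ 6 2] in auto)
    then show ?thesis
      by (rule serve_rest[OF _ QL finL]) (use Q L m early in auto)
  next
    case ii
    \<comment> \<open>Eight agents with three pairs each over four better goods:
      \<open>8 * 3 > 4 * 5\<close>, so six agents share some \<open>a\<close>. Without
      \<open>u\<close>, who accepts \<open>e 2\<close>, at least five of them remain; once
      \<open>a\<close> is gone, only three better goods are possible, as in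
      \<open>four_rich\<close>.\<close>
    have "card (rej L 2) < card L" using ii(1) L by simp
    then obtain u where u: "u \<in> L" "u \<notin> rej L 2" using rej_subset by (metis less_irrefl subsetI subset_antisym)
    have "\<forall>i\<in>L. \<exists>T\<subseteq>e ` {3..<7}. 3 \<le> card T \<and> (\<forall>a\<in>T. ptop i 5 (rest 3) a 3)"
      using tops_rest[OF weak _ rich3] ii(2) m by simp
    then obtain T where T: "\<forall>i\<in>L. T i \<subseteq> e ` {3..<7} \<and> 3 \<le> card (T i) \<and> (\<forall>a\<in>T i. ptop i 5 (rest 3) a 3)"
      by (rule bchoice[THEN exE])
    have "\<exists>a\<in>e ` {3..<7}. 5 < card {i\<in>L. a \<in> T i}"
      by (rule popular[OF finL, of _ T 3 5]) (use T L m in \<open>auto simp: card_e\<close>)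
    then obtain a where a: "a \<in> e ` {3..<7}" "5 < card {i\<in>L. a \<in> T i}" by blast
    have "5 \<le> card ({i\<in>L. a \<in> T i} - {u})" using a(2) diff_card_le_card_Diff[of "{u}" "{i\<in>L. a \<in> T i}"] by simp
    then obtain Q where Q: "Q \<subseteq> {i\<in>L. a \<in> T i} - {u}" "card Q = 5" by (rule obtain_subset_with_card_n)
    have QL: "Q \<subseteq> L" using Q(1) by blast
    have finQ: "finite Q" using QL finL by (rule finite_subset)
    have top: "ptop i (Suc 4) (rest 3) a 3" if "i \<in> Q" for i using that Q(1) T by auto
    have "sat Q (rest 3)"
    proof (rule reduce_top[OF finQ subset_refl _ _ _ top])
      fix i G' assume i: "i \<in> Q" "finite G'" "G' \<subseteq> rest 3 - {a}" "card G' = card (rest 3) - 2"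
        "\<And>j. j \<in> Q - {i} \<Longrightarrow> rich j 4 G' (3 - 1)"
      show "sat (Q - {i}) G'"
      proof (rule four_rich[of _ _ "e ` {3..<7} - {a}"])
        show "card (e ` {3..<7} - {a}) \<le> 3" using a(1) card_e[of 7 3] m by simp
        fix j x y assume "j \<in> Q - {i}" "x \<in> G'" "y \<in> G'" "x \<notin> e ` {3..<7} - {a}" "x < y"
        then show "val j {x, y} < mu j" using wk[of j x 3 y] QL i(3) by blast
      qed (use i Q finQ cr in auto)
    qed (use Q QL lev[of _ 5 3] in auto)
    then show ?thesis
    proof (rule serve_rest[OF _ QL finL])
      fix t :: nat assume t: "t < 3"
      have "card (rej L 2 - Q) \<le> card (L - Q - {u})"
        using u finL rej_subset by (intro card_mono) auto
      moreover have "card (L - Q - {u}) = 2"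
        using u Q L QL finL finQ by (subst card_Diff_singleton) (auto simp: card_Diff_subset)
      ultimately show "card (rej L t - Q) \<le> t" using early[of t] t by (cases "t = 2") auto
    qed (use Q L m in auto)
  next
    case iii
    \<comment> \<open>From five pairs on \<open>rest 2\<close>, dropping \<open>e 2\<close> and
      \<open>e 3\<close> leaves three on \<open>rest 4\<close>. Their better goods are
      \<open>e 4\<close>, \<open>e 5\<close> and \<open>e 6\<close>, so \<open>e 4\<close> serves
      all of \<open>K\<close>.\<close>
    obtain K where K: "K \<subseteq> rej L 2" "card K = 3" using obtain_subset_with_card_n[OF iii(1)] by blast
    have KL: "K \<subseteq> L" using K(1) rej_subset by blast
    have finK: "finite K" using KL finL by (rule finite_subset)
    have top: "ptop i 4 (rest 4) (e 4) 2" if "i \<in> K" for i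
    proof -
      have i: "i \<in> L" "i \<in> rej L 2" using that K KL by auto
      have "rich i (Suc 5) (rest 2) 5" using rich2[OF i(2)] by simp
      from rich_drop[OF this rest_Suc(2)[of 2], of 4] have "rich i (Suc 4) (rest 3) 4"
        using rest_Suc(1)[of 2] m by (simp add: numeral_eq_Suc)
      from rich_drop[OF this rest_Suc(2)[of 3], of 3] have "rich i 4 (rest 4) 3"
        using rest_Suc(1)[of 3] m by (simp add: numeral_eq_Suc)
      then show ?thesis using all_tops_rest[OF weak[OF i(1)], of 4 4 3] ptop_mono m by simp
    qed
    \<comment> \<open>The fourth member of the group should reject \<open>e 3\<close> if anybody
      outside \<open>K\<close> does: then at most 7 - 4 agents who reject it have to wait.\<close>
    have "\<exists>d\<in>L - K. card (rej L 3 - insert d K) \<le> 3"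
    proof (cases "rej L 3 \<subseteq> K")
      case True
      have "L \<noteq> K" using L K(2) by auto
      then have "L - K \<noteq> {}" using KL by blast
      moreover have "rej L 3 - insert d K = {}" for d using True by blast
      ultimately show ?thesis by (metis card.empty ex_in_conv zero_le)
    next
      case False
      then obtain d where d: "d \<in> rej L 3" "d \<notin> K" by blast
      have "rej L 3 \<subset> L" using iii(3) rej_subset by blast
      then have "card (rej L 3) < 8" using psubset_card_mono[OF finL] L by metis
      moreover have "insert d K \<subseteq> rej L 3" using d K(1) rej_mono[of 2 3 L] m by auto
      then have "card (rej L 3 - insert d K) = card (rej L 3) - 4"
        using d K(2) finK by (subst card_Diff_subset) auto
      moreover have "d \<in> L" using d(1) rej_subset by blast
      ultimately show ?thesis using d(2) by (intro bexI[of _ d]) auto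
    qed
    then obtain d where d: "d \<in> L" "d \<notin> K" "card (rej L 3 - insert d K) \<le> 3" by blast
    have QL: "insert d K \<subseteq> L" using d KL by blast
    have c4: "card (insert d K) = 4" using d K(2) finK by simp
    have "sat (insert d K) (rest 4)"
    proof (rule four_nine[OF c4, of _ K "e 4"])
      show "feas i 4 (rest 4)" if "i \<in> insert d K" for i using lev[of i 4 4] that QL by auto
    qed (use K top cr in auto)
    then show ?thesis
    proof (rule serve_rest[OF _ QL finL])
      fix t :: nat assume t: "t < 4"
      have "card (rej L 2 - insert d K) \<le> card (rej L 2 - K)" using finR by (intro card_mono) auto
      also have "\<dots> \<le> 2" using K iii(2) finK by (simp add: card_Diff_subset)
      finally have "card (rej L 2 - insert d K) \<le> 2" .
      moreover have "t < 2 \<or> t = 2 \<or> t = 3" using t by linarith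
      ultimately show "card (rej L t - insert d K) \<le> t" using d(3) early by auto
    qed (use c4 L m in auto)
  next
    case iv
    \<comment> \<open>Dropping \<open>e 3\<close> leaves each of these agents two pairs; eight pairs
      over three better goods make three agents share one, as \<open>four_nine\<close>
      requires.\<close>
    obtain Q where Q: "Q \<subseteq> rej L 3" "card Q = 4" using obtain_subset_with_card_n[OF iv(2)] by blast
    have QL: "Q \<subseteq> L" using Q(1) rej_subset by blast
    have finQ: "finite Q" using QL finL by (rule finite_subset)
    have rich4: "rich i 4 (rest 4) 2" if "i \<in> Q" for i
    proof -
      have "rich i (Suc 4) (rest 3) 3" using rich3 that Q(1) by auto
      from rich_drop[OF this rest_Suc(2)[of 3], of 2] show ?thesis
        using rest_Suc(1)[of 3] m by (simp add: numeral_eq_Suc)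
    qed
    have "\<forall>i\<in>Q. \<exists>T\<subseteq>e ` {4..<7}. 2 \<le> card T \<and> (\<forall>a\<in>T. ptop i 4 (rest 4) a 2)"
      using tops_rest[OF weak _ rich4] QL m by auto
    then obtain T where T: "\<forall>i\<in>Q. T i \<subseteq> e ` {4..<7} \<and> 2 \<le> card (T i) \<and> (\<forall>a\<in>T i. ptop i 4 (rest 4) a 2)"
      by (rule bchoice[THEN exE])
    have "\<exists>a\<in>e ` {4..<7}. 2 < card {i\<in>Q. a \<in> T i}"
      by (rule popular[OF finQ, of _ T 2 2]) (use T Q m in \<open>auto simp: card_e\<close>)
    then obtain a where a: "2 < card {i\<in>Q. a \<in> T i}" by blast
    have "sat Q (rest 4)"
    proof (rule four_nine[OF Q(2), of _ "{i\<in>Q. a \<in> T i}" a])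
      show "feas i 4 (rest 4)" if "i \<in> Q" for i using lev[of i 4 4] that QL by auto
    qed (use a T cr in auto)
    then show ?thesis
    proof (rule serve_rest[OF _ QL finL])
      fix t :: nat assume t: "t < 4"
      have "card (rej L 2 - Q) \<le> card (rej L 2)" using finR by (intro card_mono) auto
      then have "card (rej L 2 - Q) \<le> 2" using iv(1) by simp
      moreover have "rej L 3 \<subset> L" using iv(3) rej_subset by blast
      then have "card (rej L 3) < 8" using psubset_card_mono[OF finL] L by metis
      then have "card (rej L 3 - Q) \<le> 3" using Q finQ by (simp add: card_Diff_subset)
      moreover have "t < 2 \<or> t = 2 \<or> t = 3" using t by linarith
      ultimately show "card (rej L t - Q) \<le> t" using early by auto
    qed (use Q L m in auto)
  next
    case v
    have late: "card (rej L t - Q) \<le> t" if "t < 4" for t Q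
    proof -
      have "card (rej L 2 - Q) \<le> card (rej L 2)" "card (rej L 3 - Q) \<le> card (rej L 3)"
        using finR by (auto intro: card_mono)
      moreover have "t < 2 \<or> t = 2 \<or> t = 3" using that by linarith
      ultimately show ?thesis using v early by auto
    qed
    \<comment> \<open>If everybody rejects \<open>e 4\<close>, \<open>eight_agents\<close> applies
      to all of \<open>L\<close>. Otherwise \<open>u\<close> can wait for \<open>e 4\<close>, and
      the other seven agents are enough candidates for the ten goods of
      \<open>rest 5\<close>.\<close>
    show ?thesis
    proof (cases "rej L 4 = L")
      case True
      have "\<exists>Q\<subseteq>L. card Q = 4 \<and> sat Q (rest 4)"
      proof (rule eight_agents[OF L, of _ "e ` {4..<7}"])
        fix i assume i: "i \<in> L"
        then show "feas i 4 (rest 4)" using lev[of i 4 4] by simp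
        have "v i (e 4) < mu i" using i True by (auto simp: rej_def)
        then show "v i g < mu i" if "g \<in> rest 4" for g using rejects_rest that by blast
        show "val i {x, y} < mu i" if "x \<in> rest 4" "y \<in> rest 4" "x \<notin> e ` {4..<7}" "x < y" for x y
          using wk[OF i that] .
      qed (use m cr card_e in \<open>auto simp: card_e\<close>)
      then obtain Q where Q: "Q \<subseteq> L" "card Q = 4" "sat Q (rest 4)" by blast
      show ?thesis
        by (rule serve_rest[OF Q(3,1) finL]) (use Q L m late in auto)
    next
      case False
      then obtain u where u: "u \<in> L" "u \<notin> rej L 4" using rej_subset by blast
      have "\<exists>Q\<subseteq>L - {u}. card Q = 3 \<and> sat Q (rest 5)"
        using u finL L lev[of _ 3 5] by (intro three_sat) (auto simp: cr)
      then obtain Q where Q: "Q \<subseteq> L - {u}" "card Q = 3" "sat Q (rest 5)" by blast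
      have QL: "Q \<subseteq> L" using Q by blast
      have finQ: "finite Q" using QL finL by (rule finite_subset)
      show ?thesis
      proof (rule serve_rest[OF Q(3) QL finL])
        fix t :: nat assume t: "t < 5"
        have "card (rej L 4 - Q) \<le> card (L - Q - {u})"
          using u finL rej_subset by (intro card_mono) auto
        moreover have "card (L - Q - {u}) = 4"
          using u Q L QL finL finQ by (subst card_Diff_singleton) (auto simp: card_Diff_subset)
        moreover have "t < 4 \<or> t = 4" using t by linarith
        ultimately show "card (rej L t - Q) \<le> t" using late by auto
      qed (use Q L m in auto)
    qed
  qed
qed

end

subsection \<open>Reduction to ordered instances\<close>

context ordered_goods
begin

lemma sat_seven_more:
  assumes "8 \<le> n" "card L = n" "card G = n + 7" "\<And>i. i \<in> L \<Longrightarrow> feas i n G"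
  shows "sat L G"
  using assms
proof (induction n arbitrary: L G rule: nat_induct_at_least)
  case base
  then have "finite G" by (auto intro: card_ge_0_finite)
  then obtain e where mono: "strict_mono_on {..<card G} e" and G: "e ` {..<card G} = G" using finite_enum by blast
  interpret enum_goods v mu e 15 by unfold_locales (use mono base(2) in simp)
  have "rest 0 = G" using G base(2) by (simp add: rest_def lessThan_atLeast0)
  then show ?case using eight_fifteen base by simp
next
  case (Suc n)
  have finG: "finite G" "G \<noteq> {}" using Suc.prems(2) by (auto intro: card_ge_0_finite)
  define g where "g = Min G"
  have g: "g \<in> G" "\<And>h. h \<in> G \<Longrightarrow> g \<le> h" using finG by (auto simp: g_def)
  obtain i where i: "i \<in> L" using Suc.prems(1) by fastforce
  \<comment> \<open>There are fewer than two goods per agent, but rejecting the best good requires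
    two in every bundle.\<close>
  have "mu i \<le> v i g"
  proof (rule ccontr)
    assume "\<not> ?thesis"
    then have "v i h < mu i" if "h \<in> G" for h using anti[OF g(2)[OF that], of i] by linarith
    from reject_rich(2)[OF Suc.prems(3)[OF i] finG(2) this] show False using Suc by simp
  qed
  moreover have "sat (L - {i}) (G - {g})"
    using Suc.hyps Suc.prems i g(1) by (intro Suc.IH feas_drop) auto
  ultimately have "sat (insert i (L - {i})) G"
    using g(1) by (intro sat_insert[of _ _ "{g}"]) (auto simp: val_def)
  then show ?case using i by (simp add: insert_absorb)
qed

end

section \<open>Sorting, attained shares and picking sequences\<close>

lemma sorted_enumeration:
  fixes f :: "nat \<Rightarrow> real"
  obtains p where "bij_betw p {..<m} {1..m}" "\<And>s t. s \<le> t \<Longrightarrow> t < m \<Longrightarrow> f (p t) \<le> f (p s)"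
proof
  let ?xs = "sort_key (\<lambda>g. - f g) [1..<Suc m]"
  have "set ?xs = {1..m}" by auto
  then show "bij_betw (nth ?xs) {..<m} {1..m}" by (intro bij_betw_nth) auto
  show "f (?xs ! t) \<le> f (?xs ! s)" if "s \<le> t" "t < m" for s t
    using sorted_nth_mono[of "map (\<lambda>g. - f g) ?xs" s t] that by simp
qed

text \<open>Allocations as functions are unconstrained outside \<open>{1..n}\<close>, so there are
  infinitely many. The minimum depends only on the family of bundles, a subset of
  \<open>Pow {1..m}\<close>, which makes the set of values finite.\<close>

lemma mms_attained:
  assumes "0 < n"
  obtains A where "is_allocation n m A" "\<And>j. j \<in> {1..n} \<Longrightarrow> mms n m v i \<le> bundle_value v i (A j)"
proof -
  let ?worth = "\<lambda>A. Min ((\<lambda>j. bundle_value v i (A j)) ` {1..n})"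
  let ?S = "{?worth A |A. is_allocation n m A}"
  have "?S \<subseteq> (\<lambda>F. Min (bundle_value v i ` F)) ` Pow (Pow {1..m})"
  proof
    fix x assume "x \<in> ?S"
    then obtain A where A: "x = ?worth A" "is_allocation n m A" by blast
    have "A ` {1..n} \<in> Pow (Pow {1..m})" using A(2) unfolding is_allocation_def by blast
    moreover have "x = Min (bundle_value v i ` A ` {1..n})" using A(1) by (simp add: image_image)
    ultimately show "x \<in> (\<lambda>F. Min (bundle_value v i ` F)) ` Pow (Pow {1..m})" by blast
  qed
  then have fin: "finite ?S" by (rule finite_subset) simp
  have "is_allocation n m (\<lambda>j. if j = 1 then {1..m} else {})"
    using assms by (auto simp: is_allocation_def split: if_splits)
  then have "?S \<noteq> {}" by blast
  then have "mms n m v i \<in> ?S" unfolding mms_def using fin by (intro Max_in)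
  then obtain A where A: "mms n m v i = ?worth A" "is_allocation n m A" by blast
  have "mms n m v i \<le> bundle_value v i (A j)" if "j \<in> {1..n}" for j
    unfolding A(1) using that by (intro Min_le) auto
  with A(2) that show ?thesis by blast
qed

text \<open>Picking sequence: when the \<open>k\<close>-th pick is made, one of the \<open>k + 1\<close> favourite goods
  of the picking agent is still available.\<close>
lemma picking_sequence:
  fixes v :: "nat \<Rightarrow> nat \<Rightarrow> real" and turn :: "nat \<Rightarrow> nat"
  assumes "\<And>i. i \<in> turn ` {..<m} \<Longrightarrow> bij_betw (p i) {..<m} M"
    "\<And>i s t. i \<in> turn ` {..<m} \<Longrightarrow> s \<le> t \<Longrightarrow> t < m \<Longrightarrow> v i (p i t) \<le> v i (p i s)"
  obtains q where "inj_on q {..<m}" "q ` {..<m} \<subseteq> M"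
    "\<And>k. k < m \<Longrightarrow> v (turn k) (p (turn k) k) \<le> v (turn k) (q k)"
proof -
  have "\<exists>q. inj_on q {..<k} \<and> q ` {..<k} \<subseteq> M \<and> (\<forall>t<k. v (turn t) (p (turn t) t) \<le> v (turn t) (q t))"
    if "k \<le> m" for k
    using that
  proof (induction k)
    case (Suc k)
    then obtain q where q: "inj_on q {..<k}" "q ` {..<k} \<subseteq> M"
      "\<forall>t<k. v (turn t) (p (turn t) t) \<le> v (turn t) (q t)" by auto
    let ?p = "p (turn k)"
    have k: "turn k \<in> turn ` {..<m}" using Suc.prems by simp
    have inj: "inj_on ?p {..k}"
      by (rule inj_on_subset[OF bij_betw_imp_inj_on[OF assms(1)[OF k]]]) (use Suc.prems in auto)
    have "card (q ` {..<k}) < card (?p ` {..k})"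
      using q(1) inj by (simp add: card_image)
    then have "\<not> ?p ` {..k} \<subseteq> q ` {..<k}" by (meson card_mono finite_imageI finite_lessThan not_less)
    then obtain s where s: "s \<le> k" "?p s \<notin> q ` {..<k}" by auto
    have pM: "?p s \<in> M" using assms(1)[OF k] s(1) Suc.prems by (auto simp: bij_betw_def)
    have pv: "v (turn k) (?p k) \<le> v (turn k) (?p s)" using assms(2)[OF k s(1)] Suc.prems by simp
    define r where "r = q(k := ?p s)"
    have "inj_on r {..<Suc k}"
    proof -
      have "inj_on r {..<k}" using q(1) by (simp add: inj_on_def r_def)
      moreover have "r ` ({..<k} - {k}) = q ` {..<k}" by (auto simp: r_def)
      ultimately show ?thesis using s(2) by (simp add: lessThan_Suc inj_on_insert r_def)
    qed
    moreover have "r ` {..<Suc k} \<subseteq> M" using q(2) pM by (auto simp: r_def less_Suc_eq)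
    moreover have "v (turn t) (p (turn t) t) \<le> v (turn t) (r t)" if "t < Suc k" for t
      using q(3) pv that by (auto simp: r_def less_Suc_eq)
    ultimately show ?case by blast
  qed simp
  from this[of m] show ?thesis using that by auto
qed

theorem theorem3:
  fixes n m :: nat and v :: "nat \<Rightarrow> nat \<Rightarrow> real"
  assumes "n \<ge> 8" and "m = n + 7"
    and "\<And>i g. i \<in> {1..n} \<Longrightarrow> g \<in> {1..m} \<Longrightarrow> v i g \<ge> 0"
  shows "\<exists>A. is_mms_allocation n m v A"
proof -
  have "\<forall>i. \<exists>p. bij_betw p {..<m} {1..m} \<and> (\<forall>s t. s \<le> t \<longrightarrow> t < m \<longrightarrow> v i (p t) \<le> v i (p s))"
    using sorted_enumeration[of m] by metis
  then obtain p where p: "\<And>i. bij_betw (p i) {..<m} {1..m}"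
    "\<And>i s t. s \<le> t \<Longrightarrow> t < m \<Longrightarrow> v i (p i t) \<le> v i (p i s)" by metis
  have pM: "p i k \<in> {1..m}" if "k < m" for i k using p(1)[of i] that unfolding bij_betw_def by blast
  \<comment> \<open>The value of the \<open>k\<close>-th favourite good, counted from 0. The default
    0 makes \<open>w\<close> nonnegative and antitone for all indices, as the locale
    demands.\<close>
  define w where "w i k = (if i \<in> {1..n} \<and> k < m then v i (p i k) else 0)" for i k
  interpret ordered_goods w "mms n m v"
    by unfold_locales (use assms(3) p(2) pM in \<open>auto simp: w_def\<close>)
  have "feas i n {..<m}" if i: "i \<in> {1..n}" for i
  proof -
    obtain A where A: "is_allocation n m A" "\<And>j. j \<in> {1..n} \<Longrightarrow> mms n m v i \<le> bundle_value v i (A j)"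
      using mms_attained[of n m v i] assms(1) by auto
    let ?Q = "\<lambda>j. {k\<in>{..<m}. p i k \<in> A j}"
    have "mms n m v i \<le> val i (?Q j)" if j: "j \<in> {1..n}" for j
    proof -
      have "A j \<subseteq> {1..m}" using A(1) j unfolding is_allocation_def by blast
      then have "A j \<subseteq> p i ` {..<m}" using bij_betw_imp_surj_on[OF p(1)[of i]] by simp
      then have A_eq: "A j = p i ` ?Q j" by fast
      have inj: "inj_on (p i) (?Q j)" by (rule inj_on_subset[OF bij_betw_imp_inj_on[OF p(1)]]) auto
      have "bundle_value v i (A j) = (\<Sum>k\<in>?Q j. v i (p i k))"
        unfolding bundle_value_def by (rule sum.reindex_cong[OF inj A_eq refl])
      also have "\<dots> = val i (?Q j)" using i by (auto simp: val_def w_def intro: sum.cong)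
      finally show ?thesis using A(2)[OF j] by simp
    qed
    moreover have "disjoint_family_on ?Q {1..n}"
      using A(1) unfolding is_allocation_def disjoint_family_on_def by blast
    moreover have "1 \<in> {1..n}" "\<And>j. ?Q j \<subseteq> {..<m}" using assms(1) by auto
    ultimately have "\<exists>f. part i {1..n} {..<m} f"
      by (rule_tac pack_part[OF finite_lessThan finite_atLeastAtMost, of 1 1 n ?Q m i]) blast+
    then show ?thesis unfolding feas_def by (intro exI[of _ "{1..n}"]) simp
  qed
  then have "sat {1..n} {..<m}" using assms(1,2) by (intro sat_seven_more[of n]) auto
  then obtain B where B: "\<And>i. i \<in> {1..n} \<Longrightarrow> B i \<subseteq> {..<m}"
    "\<And>i. i \<in> {1..n} \<Longrightarrow> mms n m v i \<le> val i (B i)" "disjoint_family_on B {1..n}"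
    unfolding sat_def by blast
  \<comment> \<open>Positions in no bundle get an arbitrary picker, which is harmless because
    \<open>p\<close> ranks the goods for every index.\<close>
  define turn where "turn k = (SOME i. i \<in> {1..n} \<and> k \<in> B i)" for k
  have turn: "turn k = i" if "i \<in> {1..n}" "k \<in> B i" for i k
    unfolding turn_def using that disjoint_family_onD[OF B(3)] by (intro some_equality) blast+
  obtain q where q: "inj_on q {..<m}" "q ` {..<m} \<subseteq> {1..m}"
    "\<And>k. k < m \<Longrightarrow> v (turn k) (p (turn k) k) \<le> v (turn k) (q k)"
    using picking_sequence[of turn m p "{1..m}" v] p by metis
  \<comment> \<open>Agent 1 also receives everything unclaimed, since an allocation must exhaust the
    goods.\<close>
  define A where "A i = (if i = 1 then {1..m} - (\<Union>j\<in>{2..n}. q ` B j) else q ` B i)" for i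
  have disj: "q ` B i \<inter> q ` B j = {}" if "i \<in> {1..n}" "j \<in> {1..n}" "i \<noteq> j" for i j
    using inj_on_image_Int[OF q(1) B(1)[OF that(1)] B(1)[OF that(2)]] B(3) that
    by (auto simp: disjoint_family_on_def)
  have qB: "q ` B i \<subseteq> {1..m}" if "i \<in> {1..n}" for i using B(1)[OF that] q(2) by blast
  have one: "{1..n} = insert 1 {2..n}" using assms(1) by auto
  have first: "A 1 \<inter> (\<Union>l\<in>{2..n}. q ` B l) = {}" by (auto simp: A_def)
  have later: "A i \<subseteq> (\<Union>l\<in>{2..n}. q ` B l)" if "i \<in> {1..n}" "i \<noteq> 1" for i
  proof -
    have "i \<in> {2..n}" using that by auto
    then have "q ` B i \<subseteq> (\<Union>l\<in>{2..n}. q ` B l)" by (rule UN_upper)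
    then show ?thesis using that(2) by (simp only: A_def if_False)
  qed
  have "is_allocation n m A"
    unfolding is_allocation_def
  proof (intro conjI ballI impI)
    show "A i \<inter> A j = {}" if "i \<in> {1..n}" "j \<in> {1..n}" "i \<noteq> j" for i j
    proof (cases "i = 1 \<or> j = 1")
      case True
      then show ?thesis using first later[of i] later[of j] that by blast
    next
      case False
      then show ?thesis using disj[OF that] by (simp add: A_def)
    qed
    have "(\<Union>i\<in>{2..n}. A i) = (\<Union>i\<in>{2..n}. q ` B i)" by (auto simp: A_def)
    moreover have "(\<Union>i\<in>{2..n}. q ` B i) \<subseteq> {1..m}" by (intro UN_least qB) auto
    ultimately show "(\<Union>i\<in>{1..n}. A i) = {1..m}" unfolding one by (auto simp: A_def)
  qed
  moreover have "mms n m v i \<le> bundle_value v i (A i)" if i: "i \<in> {1..n}" for i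
  proof -
    have qA: "q ` B i \<subseteq> A i"
    proof (cases "i = 1")
      case True
      have "q ` B 1 \<inter> q ` B l = {}" if "l \<in> {2..n}" for l using disj[of 1 l] i True that by simp
      then have "q ` B 1 \<inter> (\<Union>l\<in>{2..n}. q ` B l) = {}" by (simp only: Int_UN_distrib UN_constant) simp
      moreover have "A i = {1..m} - (\<Union>l\<in>{2..n}. q ` B l)" using True by (simp add: A_def)
      moreover have "q ` B 1 \<subseteq> {1..m}" using qB[OF i] True by simp
      ultimately show ?thesis using True by blast
    next
      case False
      then show ?thesis by (simp add: A_def)
    qed
    have AM: "A i \<subseteq> {1..m}" using qB[OF i] by (auto simp: A_def)
    have "mms n m v i \<le> val i (B i)" by (rule B(2)[OF i])
    also have "\<dots> = (\<Sum>k\<in>B i. v i (p i k))"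
      unfolding val_def using B(1)[OF i] i by (intro sum.cong) (auto simp: w_def)
    also have "\<dots> \<le> (\<Sum>k\<in>B i. v i (q k))"
      using q(3) turn[OF i] B(1)[OF i] by (intro sum_mono) (metis lessThan_iff subsetD)
    also have "\<dots> = bundle_value v i (q ` B i)"
      unfolding bundle_value_def using inj_on_subset[OF q(1) B(1)[OF i]] by (simp add: sum.reindex)
    also have "\<dots> \<le> bundle_value v i (A i)"
      unfolding bundle_value_def using qA AM assms(3)[OF i]
      by (intro sum_mono2) (auto intro: finite_subset)
    finally show ?thesis .
  qed
  ultimately show ?thesis unfolding is_mms_allocation_def by blast
qed

end
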